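(* Let $0<a<1$ and $x,y>0$ with $\max\{x,y,\frac{ay}{x}\}<1$. Let $\mathbf{T}\equiv(T_1,T_2)$ be the $2$-variable weighted shift on $\ell^2(\mathbb{Z}_+^2)$ with weights $$\alpha_{(0,0)}=x,\quad \alpha_{(0,k_2)}=a\ (k_2\ge1),\quad \alpha_{(k_1,k_2)}=1\ (k_1\ge1,\ k_2\ge0),$$ $$\beta_{(0,0)}=y,\quad \beta_{(k_1,0)}=\tfrac{ay}{x}\ (k_1\ge1),\quad \beta_{(k_1,k_2)}=1\ (k_1\ge0,\ k_2\ge1).$$ Then $\mathbf{T}$ is hyponormal and not subnormal if and only if $x>a$ and $$\sqrt{\frac{1-x^2}{1-a^2}}<y\le x\sqrt{\frac{1-x^2}{x^2+a^4-2a^2x^2}}.$$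
   Context: A pair $\mathbf{T}=(T_1,T_2)$ of bounded operators on a Hilbert space $\mathcal H$ is (jointly) hyponormal if the operator matrix $\begin{pmatrix}[T_1^*,T_1]&[T_2^*,T_1]\\ [T_1^*,T_2]&[T_2^*,T_2]\end{pmatrix}$ is positive on $\mathcal H\oplus\mathcal H$, where $[S,T]=ST-TS$. It is normal if $T_1,T_2$ commute and each is normal, and subnormal if it is the restriction of a normal pair to a common invariant subspace. The $2$-variable weighted shift with bounded positive weights $\alpha_{\mathbf k},\beta_{\mathbf k}$ ($\mathbf k\in\mathbb{Z}_+^2$) is the pair on $\ell^2(\mathbb{Z}_+^2)$ given by $T_1e_{\mathbf k}=\alpha_{\mathbf k}e_{\mathbf k+(1,0)}$, $T_2e_{\mathbf k}=\beta_{\mathbf k}e_{\mathbf k+(0,1)}$. *)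

theory Defs
  imports "HOL-Analysis.Analysis"
begin

section \<open>Complex Hilbert spaces\<close>

text \<open>The inner product is linear in its first argument and conjugate-linear in its second.\<close>

class chilbert_space = banach +
  fixes scaleC :: "complex \<Rightarrow> 'a \<Rightarrow> 'a"  (infixr "*\<^sub>C" 75)
    and cinner :: "'a \<Rightarrow> 'a \<Rightarrow> complex"
  assumes scaleC_add_right: "c *\<^sub>C (x + y) = c *\<^sub>C x + c *\<^sub>C y"
    and scaleC_add_left: "(c + d) *\<^sub>C x = c *\<^sub>C x + d *\<^sub>C x"
    and scaleC_scaleC: "c *\<^sub>C (d *\<^sub>C x) = (c * d) *\<^sub>C x"
    and scaleR_scaleC: "r *\<^sub>R x = complex_of_real r *\<^sub>C x"
    and cinner_commute: "cinner x y = cnj (cinner y x)"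
    and cinner_add_left: "cinner (x + y) z = cinner x z + cinner y z"
    and cinner_scaleC_left: "cinner (c *\<^sub>C x) y = c * cinner x y"
    and cinner_self: "cinner x x = complex_of_real ((norm x)\<^sup>2)"

definition bounded_clinear :: "('a::chilbert_space \<Rightarrow> 'b::chilbert_space) \<Rightarrow> bool" where
  "bounded_clinear T \<longleftrightarrow> bounded_linear T \<and> (\<forall>c x. T (c *\<^sub>C x) = c *\<^sub>C T x)"

definition isometry :: "('a::chilbert_space \<Rightarrow> 'b::chilbert_space) \<Rightarrow> bool" where
  "isometry V \<longleftrightarrow> bounded_clinear V \<and> (\<forall>x. norm (V x) = norm x)"

text \<open>For bounded operators the adjoint exists and is unique, see \<open>cadjoint_cinner\<close>,
  \<open>cadjoint_bounded_clinear\<close> and \<open>cadjoint_eqI\<close> below.\<close>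

definition cadjoint :: "('a::chilbert_space \<Rightarrow> 'b::chilbert_space) \<Rightarrow> 'b \<Rightarrow> 'a" where
  "cadjoint T = (THE S. \<forall>x y. cinner (T x) y = cinner x (S y))"

definition positive_op :: "('a::chilbert_space \<Rightarrow> 'a) \<Rightarrow> bool" where
  "positive_op A \<longleftrightarrow> bounded_clinear A \<and> (\<forall>x. cinner (A x) x \<in> \<real>\<^sub>\<ge>\<^sub>0)"

definition commutator :: "('a::chilbert_space \<Rightarrow> 'a) \<Rightarrow> ('a \<Rightarrow> 'a) \<Rightarrow> 'a \<Rightarrow> 'a" where
  "commutator S T = (\<lambda>x. S (T x) - T (S x))"

subsection \<open>Elementary consequences\<close>

lemma cinner_add_right: "cinner x (y + z) = cinner x y + cinner x z"
  for x y z :: "'a::chilbert_space"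
  by (metis cinner_add_left cinner_commute complex_cnj_add)

lemma cinner_scaleC_right: "cinner x (c *\<^sub>C y) = cnj c * cinner x y"
  for x y :: "'a::chilbert_space"
  by (metis cinner_commute cinner_scaleC_left complex_cnj_mult)

lemma cinner_scaleR_left: "cinner (r *\<^sub>R x) y = of_real r * cinner x y"
  for x y :: "'a::chilbert_space"
  by (simp add: scaleR_scaleC cinner_scaleC_left)

lemma cinner_scaleR_right: "cinner x (r *\<^sub>R y) = of_real r * cinner x y"
  for x y :: "'a::chilbert_space"
  by (simp add: scaleR_scaleC cinner_scaleC_right)

lemma cinner_minus_left: "cinner (- x) y = - cinner x y"
  for x y :: "'a::chilbert_space"
  using cinner_scaleR_left[of "-1" x y] by simp

lemma cinner_minus_right: "cinner x (- y) = - cinner x y"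
  for x y :: "'a::chilbert_space"
  using cinner_scaleR_right[of x "-1" y] by simp

lemma cinner_diff_left: "cinner (x - y) z = cinner x z - cinner y z"
  for x y z :: "'a::chilbert_space"
  using cinner_add_left[of x "- y" z] by (simp add: cinner_minus_left)

lemma cinner_diff_right: "cinner x (y - z) = cinner x y - cinner x z"
  for x y z :: "'a::chilbert_space"
  using cinner_add_right[of x y "- z"] by (simp add: cinner_minus_right)

lemma cinner_ext:
  fixes u v :: "'a::chilbert_space"
  assumes "\<And>x. cinner x u = cinner x v"
  shows "u = v"
proof -
  have "cinner (u - v) (u - v) = 0"
    using assms[of "u - v"] by (simp add: cinner_diff_right)
  then show ?thesis by (simp add: cinner_self)
qed

lemma norm_add_power2: "(norm (x + y))\<^sup>2 = (norm x)\<^sup>2 + 2 * Re (cinner x y) + (norm y)\<^sup>2"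
  for x y :: "'a::chilbert_space"
proof -
  have "complex_of_real ((norm (x + y))\<^sup>2)
      = of_real ((norm x)\<^sup>2) + (cinner x y + cnj (cinner x y)) + of_real ((norm y)\<^sup>2)"
    unfolding cinner_self[symmetric]
    by (simp add: cinner_add_left cinner_add_right cinner_commute[of y x])
  then show ?thesis
    by (simp only: complex_add_cnj of_real_add[symmetric] of_real_eq_iff)
qed

lemma norm_diff_power2: "(norm (x - y))\<^sup>2 = (norm x)\<^sup>2 - 2 * Re (cinner x y) + (norm y)\<^sup>2"
  for x y :: "'a::chilbert_space"
  using norm_add_power2[of x "- y"] by (simp add: cinner_minus_right)

lemma bounded_clinear_bounded_linear: "bounded_clinear T \<Longrightarrow> bounded_linear T"
  by (simp add: bounded_clinear_def)

lemma linear_coeff_zero: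
  fixes p q :: real
  assumes nonneg: "\<And>t. 0 \<le> t * p + t\<^sup>2 * q"
  shows "p = 0"
proof (rule ccontr)
  assume p: "p \<noteq> 0"
  define s where "s = 1 / (\<bar>q\<bar> + 1)"
  have s: "0 < s" "s * q < 1"
    by (auto simp: s_def field_simps abs_if)
  have "(- s * p) * p + (- s * p)\<^sup>2 * q = s * p\<^sup>2 * (s * q - 1)"
    by (simp add: power2_eq_square algebra_simps)
  also have "\<dots> < 0"
    using s p by (intro mult_pos_neg) auto
  finally show False using nonneg[of "- s * p"] by linarith
qed

theorem riesz_representation:
  fixes f :: "'a::chilbert_space \<Rightarrow> complex"
  assumes lin: "bounded_linear f" and hom: "\<And>c x. f (c *\<^sub>C x) = c * f x"
  shows "\<exists>z. \<forall>x. f x = cinner x z"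
proof -
  interpret f: bounded_linear f by (rule lin)
  define J where "J x = (norm x)\<^sup>2 - 2 * Re (f x)" for x
  obtain B where B: "\<And>x. norm (f x) \<le> norm x * B"
    using f.bounded by blast
  have lower: "- B\<^sup>2 \<le> J x" for x
  proof -
    have "Re (f x) \<le> norm x * B"
      using B[of x] complex_Re_le_cmod[of "f x"] by linarith
    moreover have "0 \<le> (norm x - B)\<^sup>2" by simp
    ultimately show ?thesis
      unfolding J_def by (simp add: power2_diff)
  qed
  have bdd: "bdd_below (range J)"
    using lower by (intro bdd_belowI[of _ "- B\<^sup>2"]) auto
  define d where "d = Inf (range J)"
  have d_le: "d \<le> J x" for x
    unfolding d_def by (rule cInf_lower[OF _ bdd]) simp
  have "\<exists>x. J x < d + inverse (real (Suc n))" for n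
  proof -
    have "Inf (range J) < d + inverse (real (Suc n))" by (simp add: d_def)
    then show ?thesis by (subst (asm) cInf_less_iff[OF _ bdd]) auto
  qed
  then obtain X where X: "\<And>n. J (X n) < d + inverse (real (Suc n))" by metis
  have par: "(norm (x - y))\<^sup>2 \<le> 2 * (J x - d) + 2 * (J y - d)" for x y
  proof -
    define m where "m = (1/2) *\<^sub>R (x + y)"
    have "4 * J m = (norm (x + y))\<^sup>2 - 4 * Re (f x) - 4 * Re (f y)"
      by (simp add: m_def J_def f.add f.scaleR power_divide add_divide_distrib)
    moreover have "(norm (x + y))\<^sup>2 + (norm (x - y))\<^sup>2 = 2 * (norm x)\<^sup>2 + 2 * (norm y)\<^sup>2"
      by (simp add: norm_add_power2 norm_diff_power2)
    ultimately have "(norm (x - y))\<^sup>2 = 2 * J x + 2 * J y - 4 * J m"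
      by (simp add: J_def)
    then show ?thesis using d_le[of m] by simp
  qed
  have "Cauchy X"
  proof (rule metric_CauchyI)
    fix e :: real assume e: "0 < e"
    obtain N where N: "inverse (real (Suc N)) < e\<^sup>2 / 4"
      using reals_Archimedean[of "e\<^sup>2 / 4"] e by auto
    have small: "J (X n) - d < e\<^sup>2 / 4" if "N \<le> n" for n
    proof -
      have "inverse (real (Suc n)) \<le> inverse (real (Suc N))"
        using that by (simp add: divide_simps)
      then show ?thesis using X[of n] N by linarith
    qed
    show "\<exists>M. \<forall>m\<ge>M. \<forall>n\<ge>M. dist (X m) (X n) < e"
    proof (intro exI[of _ N] allI impI)
      fix m n assume "N \<le> m" "N \<le> n"
      then have "(norm (X m - X n))\<^sup>2 < e\<^sup>2"
        using par[of "X m" "X n"] small[of m] small[of n] by (simp add: field_simps)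
      then show "dist (X m) (X n) < e"
        using e by (simp add: dist_norm power_less_imp_less_base)
    qed
  qed
  then obtain z where z: "X \<longlonglongrightarrow> z"
    using Cauchy_convergent_iff convergent_def by blast
  have "(\<lambda>n. J (X n)) \<longlonglongrightarrow> J z"
    unfolding J_def by (intro tendsto_intros f.tendsto z)
  moreover have "(\<lambda>n. d + inverse (real (Suc n))) \<longlonglongrightarrow> d + 0"
    by (intro tendsto_intros LIMSEQ_inverse_real_of_nat)
  ultimately have "J z \<le> d + 0"
    by (rule LIMSEQ_le) (use X less_imp_le in blast)
  then have min: "J z \<le> J x" for x using d_le[of x] by linarith
  have re: "Re (cinner z y) = Re (f y)" for y
  proof -
    have "0 \<le> t * (2 * Re (cinner z y) - 2 * Re (f y)) + t\<^sup>2 * (norm y)\<^sup>2" for t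
    proof -
      have "J (z + t *\<^sub>R y) - J z
          = t * (2 * Re (cinner z y) - 2 * Re (f y)) + t\<^sup>2 * (norm y)\<^sup>2"
        by (simp add: J_def norm_add_power2 f.add f.scaleR cinner_scaleR_right
            power_mult_distrib algebra_simps)
      then show ?thesis using min[of "z + t *\<^sub>R y"] by linarith
    qed
    from linear_coeff_zero[OF this] show ?thesis by simp
  qed
  have "f x = cinner x z" for x
  proof (rule complex_eqI)
    show "Re (f x) = Re (cinner x z)"
      using re[of x] by (simp add: cinner_commute[of x z])
    show "Im (f x) = Im (cinner x z)"
      using re[of "\<i> *\<^sub>C x"]
      by (simp add: hom cinner_scaleC_right cinner_commute[of x z])
  qed
  then show ?thesis by blast
qed

lemma cinner_cauchy_schwarz: "norm (cinner x y) \<le> norm x * norm y"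
  for x y :: "'a::chilbert_space"
proof (cases "y = 0")
  case True
  have "cinner x 0 = 0" using cinner_scaleR_right[of x 0 0] by simp
  then show ?thesis using True by simp
next
  case False
  define w where "w = cinner x y"
  define c where "c = w / of_real ((norm y)\<^sup>2)"
  have ny: "(norm y)\<^sup>2 > 0" using False by simp
  have "complex_of_real ((norm (x - c *\<^sub>C y))\<^sup>2)
      = of_real ((norm x)\<^sup>2) - cnj c * w - c * cnj w + c * cnj c * of_real ((norm y)\<^sup>2)"
    unfolding cinner_self[symmetric] w_def
    by (simp add: cinner_diff_left cinner_diff_right cinner_scaleC_left cinner_scaleC_right
        cinner_commute[of y x] algebra_simps)
  also have "\<dots> = of_real ((norm x)\<^sup>2) - of_real ((cmod w)\<^sup>2) / of_real ((norm y)\<^sup>2)"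
    using ny unfolding complex_norm_square[of w]
    by (simp add: c_def field_simps power2_eq_square)
  also have "\<dots> = of_real ((norm x)\<^sup>2 - (cmod w)\<^sup>2 / (norm y)\<^sup>2)" by simp
  finally have "(norm (x - c *\<^sub>C y))\<^sup>2 = (norm x)\<^sup>2 - (cmod w)\<^sup>2 / (norm y)\<^sup>2"
    by (simp only: of_real_eq_iff)
  then have "(cmod w)\<^sup>2 / (norm y)\<^sup>2 \<le> (norm x)\<^sup>2"
    by (metis diff_ge_0_iff_ge zero_le_power2)
  then have "(cmod w)\<^sup>2 \<le> (norm x * norm y)\<^sup>2"
    using ny by (simp add: pos_divide_le_eq power_mult_distrib)
  then show ?thesis unfolding w_def by (rule power2_le_imp_le) simp
qed

lemma cadjoint_eqI:
  assumes "\<And>x y. cinner (T x) y = cinner x (S y)"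
  shows "cadjoint T = S"
  unfolding cadjoint_def
proof (rule the_equality)
  fix S' assume S': "\<forall>x y. cinner (T x) y = cinner x (S' y)"
  show "S' = S"
  proof
    fix y show "S' y = S y" by (rule cinner_ext) (metis S' assms)
  qed
qed (use assms in blast)

lemma cadjoint_cinner:
  assumes T: "bounded_clinear T"
  shows "cinner (T x) y = cinner x (cadjoint T y)"
proof -
  interpret T: bounded_linear T using T by (simp add: bounded_clinear_def)
  obtain B where B: "\<And>x. norm (T x) \<le> norm x * B" using T.bounded by blast
  have "\<exists>z. \<forall>x. cinner (T x) y = cinner x z" for y
  proof (rule riesz_representation)
    show "bounded_linear (\<lambda>x. cinner (T x) y)"
    proof (rule bounded_linear_intro)
      show "norm (cinner (T x) y) \<le> norm x * (B * norm y)" for x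
        using cinner_cauchy_schwarz[of "T x" y] mult_right_mono[OF B[of x] norm_ge_zero[of y]]
        by (simp add: mult.assoc)
    qed (auto simp: T.add T.scaleR cinner_add_left cinner_scaleR_left scaleR_conv_of_real)
    show "cinner (T (c *\<^sub>C x)) y = c * cinner (T x) y" for c x
      using T by (simp add: bounded_clinear_def cinner_scaleC_left)
  qed
  then obtain S where S: "\<And>x y. cinner (T x) y = cinner x (S y)" by metis
  then show ?thesis using cadjoint_eqI[of T S] by simp
qed

lemma cadjoint_bounded_clinear:
  assumes T: "bounded_clinear T"
  shows "bounded_clinear (cadjoint T)"
proof -
  interpret T: bounded_linear T using T by (simp add: bounded_clinear_def)
  note adj = cadjoint_cinner[OF T, symmetric]
  obtain B where B: "\<And>x. norm (T x) \<le> norm x * B" and "0 < B" using T.pos_bounded by blast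
  have hom: "cadjoint T (c *\<^sub>C y) = c *\<^sub>C cadjoint T y" for c y
    by (rule cinner_ext) (simp add: adj cinner_scaleC_right)
  moreover have "bounded_linear (cadjoint T)"
  proof (rule bounded_linear_intro)
    show "cadjoint T (x + y) = cadjoint T x + cadjoint T y" for x y
      by (rule cinner_ext) (simp add: adj cinner_add_right)
    show "cadjoint T (r *\<^sub>R x) = r *\<^sub>R cadjoint T x" for r x
      by (simp add: scaleR_scaleC hom)
    show "norm (cadjoint T y) \<le> norm y * B" for y
    proof (cases "cadjoint T y = 0")
      case True
      then show ?thesis using \<open>0 < B\<close> by simp
    next
      case False
      let ?s = "cadjoint T y"
      have "cinner (T ?s) y = of_real ((norm ?s)\<^sup>2)"
        by (simp only: cadjoint_cinner[OF T] cinner_self)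
      then have "norm (cinner (T ?s) y) = (norm ?s)\<^sup>2"
        by (simp only: norm_of_real) simp
      then have "(norm ?s)\<^sup>2 \<le> norm (T ?s) * norm y"
        using cinner_cauchy_schwarz[of "T ?s" y] by simp
      also have "\<dots> \<le> (norm ?s * B) * norm y" by (intro mult_right_mono B) simp
      finally have "norm ?s * norm ?s \<le> norm ?s * (norm y * B)"
        by (simp add: power2_eq_square mult_ac)
      then show ?thesis using False by simp
    qed
  qed
  ultimately show ?thesis by (simp add: bounded_clinear_def)
qed

subsection \<open>The orthogonal direct sum of two Hilbert spaces\<close>

instantiation prod :: (chilbert_space, chilbert_space) chilbert_space
begin

definition scaleC_prod :: "complex \<Rightarrow> 'a \<times> 'b \<Rightarrow> 'a \<times> 'b" where
  "scaleC_prod c u = (c *\<^sub>C fst u, c *\<^sub>C snd u)"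

definition cinner_prod :: "'a \<times> 'b \<Rightarrow> 'a \<times> 'b \<Rightarrow> complex" where
  "cinner_prod u v = cinner (fst u) (fst v) + cinner (snd u) (snd v)"

instance
proof
  fix c d :: complex and r :: real and x y z :: "'a \<times> 'b"
  show "c *\<^sub>C (x + y) = c *\<^sub>C x + c *\<^sub>C y"
    by (simp add: scaleC_prod_def scaleC_add_right)
  show "(c + d) *\<^sub>C x = c *\<^sub>C x + d *\<^sub>C x"
    by (simp add: scaleC_prod_def scaleC_add_left)
  show "c *\<^sub>C (d *\<^sub>C x) = (c * d) *\<^sub>C x"
    by (simp add: scaleC_prod_def scaleC_scaleC)
  show "r *\<^sub>R x = complex_of_real r *\<^sub>C x"
    by (simp add: scaleC_prod_def scaleR_prod_def scaleR_scaleC)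
  show "cinner x y = cnj (cinner y x)"
    by (simp add: cinner_prod_def cinner_commute[of "fst x"] cinner_commute[of "snd x"])
  show "cinner (x + y) z = cinner x z + cinner y z"
    by (simp add: cinner_prod_def cinner_add_left)
  show "cinner (c *\<^sub>C x) y = c * cinner x y"
    by (simp add: cinner_prod_def scaleC_prod_def cinner_scaleC_left algebra_simps)
  show "cinner x x = complex_of_real ((norm x)\<^sup>2)"
    by (simp add: cinner_prod_def norm_prod_def cinner_self)
qed

end

section \<open>Hyponormal, normal and subnormal pairs\<close>

definition op_matrix ::
  "('a::chilbert_space \<Rightarrow> 'a) \<Rightarrow> ('a \<Rightarrow> 'a) \<Rightarrow> ('a \<Rightarrow> 'a) \<Rightarrow> ('a \<Rightarrow> 'a) \<Rightarrow> 'a \<times> 'a \<Rightarrow> 'a \<times> 'a" where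
  "op_matrix A B C D = (\<lambda>(u, v). (A u + B v, C u + D v))"

definition hyponormal_pair ::
  "('a::chilbert_space \<Rightarrow> 'a) \<Rightarrow> ('a \<Rightarrow> 'a) \<Rightarrow> bool" where
  "hyponormal_pair T1 T2 \<longleftrightarrow>
     bounded_clinear T1 \<and> bounded_clinear T2 \<and>
     positive_op (op_matrix
       (commutator (cadjoint T1) T1) (commutator (cadjoint T2) T1)
       (commutator (cadjoint T1) T2) (commutator (cadjoint T2) T2))"

definition normal_op :: "('a::chilbert_space \<Rightarrow> 'a) \<Rightarrow> bool" where
  "normal_op N \<longleftrightarrow> bounded_clinear N \<and> cadjoint N \<circ> N = N \<circ> cadjoint N"

definition normal_pair :: "('a::chilbert_space \<Rightarrow> 'a) \<Rightarrow> ('a \<Rightarrow> 'a) \<Rightarrow> bool" where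
  "normal_pair N1 N2 \<longleftrightarrow> N1 \<circ> N2 = N2 \<circ> N1 \<and> normal_op N1 \<and> normal_op N2"

text \<open>A pair on a Hilbert space \<open>H\<close> is subnormal if, for some Hilbert space \<open>K\<close> containing \<open>H\<close>,
  it is the restriction to \<open>H\<close> of a normal pair on \<open>K\<close> leaving \<open>H\<close> invariant. The inclusion of
  \<open>H\<close> into \<open>K\<close> is an isometry \<open>V\<close>, and invariance of its range together with
  the restriction property is expressed by \<open>N1 \<circ> V = V \<circ> T1\<close> and \<open>N2 \<circ> V = V \<circ> T2\<close>.
  A definition cannot quantify over the type of \<open>K\<close>, which is therefore an argument: being
  subnormal means \<open>subnormal_pair_in TYPE('k)\<close> for some \<open>'k\<close>, and only types \<open>'k\<close> admitting some
  isometry from \<open>H\<close> can occur.\<close>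

definition subnormal_pair_in ::
  "'k::chilbert_space itself \<Rightarrow> ('a::chilbert_space \<Rightarrow> 'a) \<Rightarrow> ('a \<Rightarrow> 'a) \<Rightarrow> bool" where
  "subnormal_pair_in _ T1 T2 \<longleftrightarrow>
     bounded_clinear T1 \<and> bounded_clinear T2 \<and>
     (\<exists>(V :: 'a \<Rightarrow> 'k) N1 N2. isometry V \<and> normal_pair N1 N2 \<and>
        N1 \<circ> V = V \<circ> T1 \<and> N2 \<circ> V = V \<circ> T2)"

section \<open>Square-summable families\<close>

definition square_summable :: "('i \<Rightarrow> complex) \<Rightarrow> bool" where
  "square_summable f \<longleftrightarrow> (\<lambda>i. (cmod (f i))\<^sup>2) summable_on UNIV"

definition ell2_norm :: "('i \<Rightarrow> complex) \<Rightarrow> real" where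
  "ell2_norm f = sqrt (\<Sum>\<^sub>\<infinity>i. (cmod (f i))\<^sup>2)"

lemma square_summable_L2_set_le:
  assumes "square_summable f" "finite F"
  shows "L2_set (\<lambda>i. cmod (f i)) F \<le> ell2_norm f"
  unfolding L2_set_def ell2_norm_def
  using assms unfolding square_summable_def
  by (intro real_sqrt_le_mono finite_sum_le_infsum) auto

lemma L2_set_le_imp_square_summable:
  assumes "\<And>F. finite F \<Longrightarrow> L2_set (\<lambda>i. cmod (f i)) F \<le> B"
  shows "square_summable f" "ell2_norm f \<le> B"
proof -
  have B: "0 \<le> B" using assms[of "{}"] by simp
  have le: "(\<Sum>i\<in>F. (cmod (f i))\<^sup>2) \<le> B\<^sup>2" if "finite F" for F
    using assms[OF that] B unfolding L2_set_def
    by (metis real_sqrt_le_iff real_sqrt_unique)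
  show *: "square_summable f"
    unfolding square_summable_def
    by (rule nonneg_bdd_above_summable_on) (auto intro!: bdd_aboveI2 le)
  have "(\<Sum>\<^sub>\<infinity>i. (cmod (f i))\<^sup>2) \<le> B\<^sup>2"
    using * unfolding square_summable_def by (rule infsum_le_finite_sums) (rule le)
  then show "ell2_norm f \<le> B"
    unfolding ell2_norm_def using B real_le_lsqrt infsum_nonneg
    by (metis real_sqrt_le_iff real_sqrt_unique)
qed

lemma square_summable_add:
  assumes f: "square_summable f" and g: "square_summable g"
  shows "square_summable (\<lambda>i. f i + g i)" "ell2_norm (\<lambda>i. f i + g i) \<le> ell2_norm f + ell2_norm g"
proof -
  have *: "L2_set (\<lambda>i. cmod (f i + g i)) F \<le> ell2_norm f + ell2_norm g" if "finite F" for F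
  proof -
    have "L2_set (\<lambda>i. cmod (f i + g i)) F \<le> L2_set (\<lambda>i. cmod (f i) + cmod (g i)) F"
      by (intro L2_set_mono norm_triangle_ineq) auto
    also have "\<dots> \<le> L2_set (\<lambda>i. cmod (f i)) F + L2_set (\<lambda>i. cmod (g i)) F"
      by (rule L2_set_triangle_ineq)
    also have "\<dots> \<le> ell2_norm f + ell2_norm g"
      by (intro add_mono square_summable_L2_set_le f g that)
    finally show ?thesis .
  qed
  from L2_set_le_imp_square_summable[OF *]
  show "square_summable (\<lambda>i. f i + g i)" "ell2_norm (\<lambda>i. f i + g i) \<le> ell2_norm f + ell2_norm g"
    by auto
qed

lemma square_summable_scale:
  assumes f: "square_summable f"
  shows "square_summable (\<lambda>i. c * f i)"
  using f unfolding square_summable_def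
  by (simp add: norm_mult power_mult_distrib summable_on_cmult_right)

lemma ell2_norm_scale: "ell2_norm (\<lambda>i. c * f i) = cmod c * ell2_norm f"
  by (simp add: ell2_norm_def norm_mult power_mult_distrib infsum_cmult_right' real_sqrt_mult)

lemma square_summable_product:
  assumes f: "square_summable f" and g: "square_summable g"
  shows "(\<lambda>i. f i * cnj (g i)) summable_on UNIV"
proof (rule abs_summable_summable, rule summable_on_comparison_test)
  show "(\<lambda>i. (cmod (f i))\<^sup>2 + (cmod (g i))\<^sup>2) summable_on UNIV"
    using f g unfolding square_summable_def by (rule summable_on_add)
  show "cmod (f i * cnj (g i)) \<le> (cmod (f i))\<^sup>2 + (cmod (g i))\<^sup>2" for i
  proof -
    have "0 \<le> (cmod (f i) - cmod (g i))\<^sup>2" "0 \<le> (cmod (f i))\<^sup>2 + (cmod (g i))\<^sup>2" by auto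
    then have "cmod (f i) * cmod (g i) \<le> (cmod (f i))\<^sup>2 + (cmod (g i))\<^sup>2"
      using mult_nonneg_nonneg[OF norm_ge_zero[of "f i"] norm_ge_zero[of "g i"]]
      unfolding power2_diff by linarith
    then show ?thesis by (simp add: norm_mult)
  qed
qed auto

typedef 'i ell2 = "{f :: 'i \<Rightarrow> complex. square_summable f}"
  morphisms ell2_coord Abs_ell2
  by (rule exI[of _ "\<lambda>_. 0"]) (simp add: square_summable_def)

setup_lifting type_definition_ell2

lemma square_summable_ell2_coord: "square_summable (ell2_coord f)"
  using ell2_coord by blast

instantiation ell2 :: (type) real_normed_vector
begin

lift_definition zero_ell2 :: "'a ell2" is "\<lambda>_. 0"
  by (simp add: square_summable_def)

lift_definition plus_ell2 :: "'a ell2 \<Rightarrow> 'a ell2 \<Rightarrow> 'a ell2" is "\<lambda>f g i. f i + g i"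
  by (rule square_summable_add)

lift_definition uminus_ell2 :: "'a ell2 \<Rightarrow> 'a ell2" is "\<lambda>f i. - f i"
  by (simp add: square_summable_def)

lift_definition minus_ell2 :: "'a ell2 \<Rightarrow> 'a ell2 \<Rightarrow> 'a ell2" is "\<lambda>f g i. f i - g i"
  subgoal for f g
    using square_summable_add(1)[of f "\<lambda>i. - g i"] by (simp add: square_summable_def)
  done

lift_definition scaleR_ell2 :: "real \<Rightarrow> 'a ell2 \<Rightarrow> 'a ell2" is "\<lambda>r f i. complex_of_real r * f i"
  by (rule square_summable_scale)

lift_definition norm_ell2 :: "'a ell2 \<Rightarrow> real" is ell2_norm .

definition dist_ell2 :: "'a ell2 \<Rightarrow> 'a ell2 \<Rightarrow> real" where
  "dist_ell2 f g = norm (f - g)"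

definition sgn_ell2 :: "'a ell2 \<Rightarrow> 'a ell2" where
  "sgn_ell2 f = inverse (norm f) *\<^sub>R f"

definition uniformity_ell2 :: "('a ell2 \<times> 'a ell2) filter" where
  "uniformity_ell2 = (INF e\<in>{0<..}. principal {(f, g). dist f g < e})"

definition open_ell2 :: "'a ell2 set \<Rightarrow> bool" where
  "open_ell2 U \<longleftrightarrow> (\<forall>f\<in>U. \<forall>\<^sub>F (f', g) in uniformity. f' = f \<longrightarrow> g \<in> U)"

instance
proof intro_classes
  fix a b :: real and f g h :: "'a ell2" and U :: "'a ell2 set"
  show "f + g + h = f + (g + h)" by transfer (simp add: algebra_simps)
  show "f + g = g + f" by transfer (simp add: algebra_simps)
  show "0 + f = f" by transfer simp
  show "- f + f = 0" by transfer simp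
  show "f - g = f + - g" by transfer simp
  show "a *\<^sub>R (f + g) = a *\<^sub>R f + a *\<^sub>R g" by transfer (simp add: algebra_simps)
  show "(a + b) *\<^sub>R f = a *\<^sub>R f + b *\<^sub>R f" by transfer (simp add: algebra_simps)
  show "a *\<^sub>R b *\<^sub>R f = (a * b) *\<^sub>R f" by transfer (simp add: algebra_simps)
  show "1 *\<^sub>R f = f" by transfer simp
  show "dist f g = norm (f - g)" by (rule dist_ell2_def)
  show "sgn f = inverse (norm f) *\<^sub>R f" by (rule sgn_ell2_def)
  show "uniformity = (INF e\<in>{0<..}. principal {(f :: 'a ell2, g). dist f g < e})"
    by (rule uniformity_ell2_def)
  show "open U \<longleftrightarrow> (\<forall>f\<in>U. \<forall>\<^sub>F (f', g) in uniformity. f' = f \<longrightarrow> g \<in> U)"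
    by (rule open_ell2_def)
  show "norm f = 0 \<longleftrightarrow> f = 0"
  proof (transfer, safe)
    fix f :: "'a \<Rightarrow> complex" assume f: "square_summable f" and "ell2_norm f = 0"
    then have le: "(\<Sum>\<^sub>\<infinity>i. (cmod (f i))\<^sup>2) \<le> 0" by (simp add: ell2_norm_def)
    show "f = (\<lambda>_. 0)"
    proof
      fix i
      have "(cmod (f i))\<^sup>2 = 0"
        using f unfolding square_summable_def by (intro nonneg_infsum_le_0D[OF le]) auto
      then show "f i = 0" by simp
    qed
  qed (simp add: ell2_norm_def)
  show "norm (f + g) \<le> norm f + norm g" by transfer (rule square_summable_add)
  show "norm (a *\<^sub>R f) = \<bar>a\<bar> * norm f" by transfer (simp add: ell2_norm_scale)
qed

end

instance ell2 :: (type) banach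
proof
  fix X :: "nat \<Rightarrow> 'a ell2" assume X: "Cauchy X"
  have fin: "L2_set (\<lambda>i. cmod (ell2_coord (X m) i - ell2_coord (X n) i)) F \<le> norm (X m - X n)"
    if "finite F" for F m n
    using square_summable_L2_set_le[OF square_summable_ell2_coord that, of "X m - X n"]
    by (simp add: minus_ell2.rep_eq norm_ell2.rep_eq)
  have coord: "cmod (ell2_coord (X m) i - ell2_coord (X n) i) \<le> norm (X m - X n)" for m n i
    using fin[of "{i}" m n] by simp
  have "Cauchy (\<lambda>n. ell2_coord (X n) i)" for i
  proof (rule metric_CauchyI)
    fix e :: real assume "0 < e"
    then obtain M where M: "\<forall>m\<ge>M. \<forall>n\<ge>M. norm (X m - X n) < e"
      using X unfolding Cauchy_def dist_ell2_def by blast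
    then show "\<exists>M. \<forall>m\<ge>M. \<forall>n\<ge>M. dist (ell2_coord (X m) i) (ell2_coord (X n) i) < e"
      using le_less_trans[OF coord] unfolding dist_norm by blast
  qed
  then have "\<exists>l. (\<lambda>n. ell2_coord (X n) i) \<longlonglongrightarrow> l" for i
    using Cauchy_convergent_iff convergent_def by blast
  then obtain g where g: "\<And>i. (\<lambda>n. ell2_coord (X n) i) \<longlonglongrightarrow> g i" by metis
  have tail: "\<exists>M. \<forall>m\<ge>M. square_summable (\<lambda>i. ell2_coord (X m) i - g i) \<and>
      ell2_norm (\<lambda>i. ell2_coord (X m) i - g i) \<le> e" if "0 < e" for e
  proof -
    obtain M where M: "\<forall>m\<ge>M. \<forall>n\<ge>M. norm (X m - X n) < e"
      using X \<open>0 < e\<close> unfolding Cauchy_def dist_ell2_def by blast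
    have le: "L2_set (\<lambda>i. cmod (ell2_coord (X m) i - g i)) F \<le> e" if "M \<le> m" "finite F" for m F
    proof (rule LIMSEQ_le_const2)
      show "(\<lambda>n. L2_set (\<lambda>i. cmod (ell2_coord (X m) i - ell2_coord (X n) i)) F)
          \<longlonglongrightarrow> L2_set (\<lambda>i. cmod (ell2_coord (X m) i - g i)) F"
        unfolding L2_set_def by (intro tendsto_intros g)
      show "\<exists>N. \<forall>n\<ge>N. L2_set (\<lambda>i. cmod (ell2_coord (X m) i - ell2_coord (X n) i)) F \<le> e"
        using fin[OF \<open>finite F\<close>, of m] M \<open>M \<le> m\<close> by (meson less_imp_le order_trans)
    qed
    show ?thesis
      using L2_set_le_imp_square_summable[OF le] by blast
  qed
  obtain m where "square_summable (\<lambda>i. ell2_coord (X m) i - g i)"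
    using tail[of 1] by auto
  then have "square_summable (\<lambda>i. ell2_coord (X m) i + - 1 * (ell2_coord (X m) i - g i))"
    by (intro square_summable_add square_summable_ell2_coord square_summable_scale)
  then have "square_summable g" by simp
  then obtain G where G: "ell2_coord G = g" by (metis Abs_ell2_inverse mem_Collect_eq)
  have "X \<longlonglongrightarrow> G"
  proof (rule metric_LIMSEQ_I)
    fix e :: real assume "0 < e"
    then obtain M where M: "\<forall>m\<ge>M. ell2_norm (\<lambda>i. ell2_coord (X m) i - g i) \<le> e / 2"
      using tail[of "e / 2"] by auto
    have "dist (X m) G < e" if "M \<le> m" for m
    proof -
      have "dist (X m) G \<le> e / 2"
        using M that by (simp add: dist_ell2_def norm_ell2.rep_eq minus_ell2.rep_eq G)
      then show ?thesis using \<open>0 < e\<close> by linarith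
    qed
    then show "\<exists>M. \<forall>m\<ge>M. dist (X m) G < e" by blast
  qed
  then show "convergent X" by (rule convergentI)
qed

instantiation ell2 :: (type) chilbert_space
begin

lift_definition scaleC_ell2 :: "complex \<Rightarrow> 'a ell2 \<Rightarrow> 'a ell2" is "\<lambda>c f i. c * f i"
  by (rule square_summable_scale)

lift_definition cinner_ell2 :: "'a ell2 \<Rightarrow> 'a ell2 \<Rightarrow> complex"
  is "\<lambda>f g. \<Sum>\<^sub>\<infinity>i. f i * cnj (g i)" .

instance
proof
  fix a :: real and c d :: complex and f g h :: "'a ell2"
  show "c *\<^sub>C (f + g) = c *\<^sub>C f + c *\<^sub>C g" by transfer (simp add: algebra_simps)
  show "(c + d) *\<^sub>C f = c *\<^sub>C f + d *\<^sub>C f" by transfer (simp add: algebra_simps)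
  show "c *\<^sub>C d *\<^sub>C f = (c * d) *\<^sub>C f" by transfer (simp add: algebra_simps)
  show "a *\<^sub>R f = complex_of_real a *\<^sub>C f" by transfer simp
  show "cinner f g = cnj (cinner g f)"
    by transfer (simp add: infsum_cnj[symmetric] mult.commute del: infsum_cnj)
  show "cinner (f + g) h = cinner f h + cinner g h"
    by transfer (simp add: distrib_right infsum_add square_summable_product)
  show "cinner (c *\<^sub>C f) g = c * cinner f g"
    by transfer (simp add: mult.assoc infsum_cmult_right')
  show "cinner f f = complex_of_real ((norm f)\<^sup>2)"
  proof transfer
    fix f :: "'a \<Rightarrow> complex" assume f: "square_summable f"
    have "((\<lambda>i. complex_of_real ((cmod (f i))\<^sup>2)) has_sum
        complex_of_real (\<Sum>\<^sub>\<infinity>i. (cmod (f i))\<^sup>2)) UNIV"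
      using f unfolding square_summable_def by (intro has_sum_of_real has_sum_infsum)
    then have "(\<Sum>\<^sub>\<infinity>i. f i * cnj (f i)) = complex_of_real (\<Sum>\<^sub>\<infinity>i. (cmod (f i))\<^sup>2)"
      by (simp only: complex_norm_square[symmetric] infsumI)
    then show "(\<Sum>\<^sub>\<infinity>i. f i * cnj (f i)) = complex_of_real ((ell2_norm f)\<^sup>2)"
      by (simp add: ell2_norm_def infsum_nonneg)
  qed
qed

end

lift_definition ket :: "'i \<Rightarrow> 'i ell2" is "\<lambda>k i. if i = k then 1 else 0"
  subgoal for k
    unfolding square_summable_def
    by (rule finite_nonzero_values_imp_summable_on) (rule finite_subset[of _ "{k}"], auto)
  done

section \<open>Two-variable weighted shifts\<close>

text \<open>Both operators are given in coordinates, for instance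
  \<open>(T1 f)(k1 + 1, k2) = \<alpha>(k1, k2) * f(k1, k2)\<close> and \<open>(T1 f)(0, k2) = 0\<close>; the action on the
  basis vectors is \<open>shift1_ket\<close> and \<open>shift2_ket\<close>, and boundedness for bounded weights is
  \<open>shift1_bounded_clinear\<close> and \<open>shift2_bounded_clinear\<close>.\<close>

definition shift1_coord :: "(nat \<times> nat \<Rightarrow> real) \<Rightarrow> (nat \<times> nat \<Rightarrow> complex) \<Rightarrow> nat \<times> nat \<Rightarrow> complex" where
  "shift1_coord \<alpha> f = (\<lambda>(k1, k2). if k1 = 0 then 0
     else complex_of_real (\<alpha> (k1 - 1, k2)) * f (k1 - 1, k2))"

definition shift2_coord :: "(nat \<times> nat \<Rightarrow> real) \<Rightarrow> (nat \<times> nat \<Rightarrow> complex) \<Rightarrow> nat \<times> nat \<Rightarrow> complex" where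
  "shift2_coord \<beta> f = (\<lambda>(k1, k2). if k2 = 0 then 0
     else complex_of_real (\<beta> (k1, k2 - 1)) * f (k1, k2 - 1))"

definition shift1 :: "(nat \<times> nat \<Rightarrow> real) \<Rightarrow> (nat \<times> nat) ell2 \<Rightarrow> (nat \<times> nat) ell2" where
  "shift1 \<alpha> f = Abs_ell2 (shift1_coord \<alpha> (ell2_coord f))"

definition shift2 :: "(nat \<times> nat \<Rightarrow> real) \<Rightarrow> (nat \<times> nat) ell2 \<Rightarrow> (nat \<times> nat) ell2" where
  "shift2 \<beta> f = Abs_ell2 (shift2_coord \<beta> (ell2_coord f))"

lemma weighted_translate_square_summable:
  fixes f :: "'i \<Rightarrow> complex" and w :: "'i \<Rightarrow> real" and s :: "'i \<Rightarrow> 'i"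
  assumes f: "square_summable f" and w: "\<And>k. \<bar>w k\<bar> \<le> B" and s: "inj s"
    and g: "\<And>k. g (s k) = complex_of_real (w k) * f k" "\<And>k. k \<notin> range s \<Longrightarrow> g k = 0"
  shows "square_summable g" "ell2_norm g \<le> B * ell2_norm f"
proof -
  have B: "0 \<le> B" using w[of undefined] by linarith
  have *: "L2_set (\<lambda>i. cmod (g i)) F \<le> B * ell2_norm f" if F: "finite F" for F
  proof -
    have fin: "finite (s -` F)" using F s by (simp add: finite_vimageI)
    have "(\<Sum>i\<in>F. (cmod (g i))\<^sup>2) = (\<Sum>i\<in>s ` (s -` F). (cmod (g i))\<^sup>2)"
      by (rule sum.mono_neutral_right) (use F g(2) in auto)
    also have "\<dots> = (\<Sum>k\<in>s -` F. (cmod (g (s k)))\<^sup>2)"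
      using s by (subst sum.reindex) (auto simp: inj_on_def)
    also have "\<dots> \<le> (\<Sum>k\<in>s -` F. (B * cmod (f k))\<^sup>2)"
    proof (rule sum_mono)
      fix k
      have "cmod (g (s k)) \<le> B * cmod (f k)"
        by (simp add: g(1) norm_mult mult_right_mono w)
      then show "(cmod (g (s k)))\<^sup>2 \<le> (B * cmod (f k))\<^sup>2" by (intro power_mono) auto
    qed
    finally have "L2_set (\<lambda>i. cmod (g i)) F \<le> L2_set (\<lambda>k. B * cmod (f k)) (s -` F)"
      unfolding L2_set_def by (rule real_sqrt_le_mono)
    also have "\<dots> = B * L2_set (\<lambda>k. cmod (f k)) (s -` F)"
      by (simp add: L2_set_right_distrib B)
    also have "\<dots> \<le> B * ell2_norm f"
      by (intro mult_left_mono square_summable_L2_set_le f fin B)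
    finally show ?thesis .
  qed
  from L2_set_le_imp_square_summable[OF *]
  show "square_summable g" "ell2_norm g \<le> B * ell2_norm f" by auto
qed

lemma shift1_coord_bound:
  assumes "\<And>k. \<bar>\<alpha> k\<bar> \<le> B" "square_summable f"
  shows "square_summable (shift1_coord \<alpha> f)" "ell2_norm (shift1_coord \<alpha> f) \<le> B * ell2_norm f"
proof -
  have inj: "inj (\<lambda>(k1, k2). (Suc k1, k2 :: nat))" by (auto simp: inj_on_def)
  have out: "shift1_coord \<alpha> f k = 0" if "k \<notin> range (\<lambda>(k1, k2). (Suc k1, k2))" for k
    using that by (cases k; cases "fst k") (auto simp: shift1_coord_def image_iff)
  show "square_summable (shift1_coord \<alpha> f)" "ell2_norm (shift1_coord \<alpha> f) \<le> B * ell2_norm f"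
    by (rule weighted_translate_square_summable[OF assms(2,1) inj _ out];
        force simp: shift1_coord_def)+
qed

lemma shift2_coord_bound:
  assumes "\<And>k. \<bar>\<beta> k\<bar> \<le> B" "square_summable f"
  shows "square_summable (shift2_coord \<beta> f)" "ell2_norm (shift2_coord \<beta> f) \<le> B * ell2_norm f"
proof -
  have inj: "inj (\<lambda>(k1 :: nat, k2). (k1, Suc k2))" by (auto simp: inj_on_def)
  have out: "shift2_coord \<beta> f k = 0" if "k \<notin> range (\<lambda>(k1, k2). (k1, Suc k2))" for k
    using that by (cases k; cases "snd k") (auto simp: shift2_coord_def image_iff)
  show "square_summable (shift2_coord \<beta> f)" "ell2_norm (shift2_coord \<beta> f) \<le> B * ell2_norm f"
    by (rule weighted_translate_square_summable[OF assms(2,1) inj _ out];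
        force simp: shift2_coord_def)+
qed

lemma ell2_coord_shift1:
  assumes "\<And>k. \<bar>\<alpha> k\<bar> \<le> B"
  shows "ell2_coord (shift1 \<alpha> f) = shift1_coord \<alpha> (ell2_coord f)"
  unfolding shift1_def
  by (rule Abs_ell2_inverse) (simp add: shift1_coord_bound(1)[OF assms square_summable_ell2_coord])

lemma ell2_coord_shift2:
  assumes "\<And>k. \<bar>\<beta> k\<bar> \<le> B"
  shows "ell2_coord (shift2 \<beta> f) = shift2_coord \<beta> (ell2_coord f)"
  unfolding shift2_def
  by (rule Abs_ell2_inverse) (simp add: shift2_coord_bound(1)[OF assms square_summable_ell2_coord])

lemma shift1_bounded_clinear:
  assumes w: "\<And>k. \<bar>\<alpha> k\<bar> \<le> B"
  shows "bounded_clinear (shift1 \<alpha>)"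
  unfolding bounded_clinear_def
proof (intro conjI allI bounded_linear_intro)
  show "norm (shift1 \<alpha> f) \<le> norm f * B" for f
    using shift1_coord_bound(2)[OF w square_summable_ell2_coord]
    by (simp add: norm_ell2.rep_eq ell2_coord_shift1[OF w] mult.commute)
qed (auto simp: ell2_coord_inject[symmetric] ell2_coord_shift1[OF w] plus_ell2.rep_eq
    scaleR_ell2.rep_eq scaleC_ell2.rep_eq shift1_coord_def fun_eq_iff algebra_simps)

lemma shift2_bounded_clinear:
  assumes w: "\<And>k. \<bar>\<beta> k\<bar> \<le> B"
  shows "bounded_clinear (shift2 \<beta>)"
  unfolding bounded_clinear_def
proof (intro conjI allI bounded_linear_intro)
  show "norm (shift2 \<beta> f) \<le> norm f * B" for f
    using shift2_coord_bound(2)[OF w square_summable_ell2_coord]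
    by (simp add: norm_ell2.rep_eq ell2_coord_shift2[OF w] mult.commute)
qed (auto simp: ell2_coord_inject[symmetric] ell2_coord_shift2[OF w] plus_ell2.rep_eq
    scaleR_ell2.rep_eq scaleC_ell2.rep_eq shift2_coord_def fun_eq_iff algebra_simps)

lemma shift1_ket:
  assumes w: "\<And>k. \<bar>\<alpha> k\<bar> \<le> B"
  shows "shift1 \<alpha> (ket (k1, k2)) = complex_of_real (\<alpha> (k1, k2)) *\<^sub>C ket (k1 + 1, k2)"
  by (auto simp: ell2_coord_inject[symmetric] ell2_coord_shift1[OF w] scaleC_ell2.rep_eq
      ket.rep_eq shift1_coord_def fun_eq_iff)

lemma shift2_ket:
  assumes w: "\<And>k. \<bar>\<beta> k\<bar> \<le> B"
  shows "shift2 \<beta> (ket (k1, k2)) = complex_of_real (\<beta> (k1, k2)) *\<^sub>C ket (k1, k2 + 1)"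
  by (auto simp: ell2_coord_inject[symmetric] ell2_coord_shift2[OF w] scaleC_ell2.rep_eq
      ket.rep_eq shift2_coord_def fun_eq_iff)

definition weight1 :: "real \<Rightarrow> real \<Rightarrow> nat \<times> nat \<Rightarrow> real" where
  "weight1 a x = (\<lambda>(k1, k2). if k1 \<ge> 1 then 1 else if k2 \<ge> 1 then a else x)"

definition weight2 :: "real \<Rightarrow> real \<Rightarrow> real \<Rightarrow> nat \<times> nat \<Rightarrow> real" where
  "weight2 a x y = (\<lambda>(k1, k2). if k2 \<ge> 1 then 1 else if k1 \<ge> 1 then a * y / x else y)"

end

theory Submission
  imports Defs
begin

text \<open>
  Hyponormality and subnormality are characterised separately, by one inequality each.

  In the standard basis the matrix of commutators of a two-variable weighted shift
  decomposes into two-by-two blocks, one for each lattice point, and nonnegative scalars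
  (\<open>hyponormal_pair_shift_iff\<close>). For the present weights all blocks but the one at the origin
  are diagonal with nonnegative entries, so hyponormality is the determinant condition for that
  single block (\<open>hyponormal_pair_weights_iff\<close>). Solved for \<open>y\<close>, this is the upper bound of the
  theorem.

  Subnormality is a moment problem. The squared norms of \<open>T1\<^sup>i T2\<^sup>j e\<close>, where \<open>e\<close> is the basis vector at the
  origin, equal \<open>1\<close>, \<open>x\<^sup>2\<close> (\<open>i > 0 = j\<close>), \<open>y\<^sup>2\<close> (\<open>i = 0 < j\<close>) and \<open>a\<^sup>2 y\<^sup>2\<close> (\<open>i, j > 0\<close>). They are
  the moments of the signed measure on \<open>{0, 1}\<^sup>2\<close> whose masses at \<open>(1, 1)\<close>, \<open>(1, 0)\<close>, \<open>(0, 1)\<close> and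
  \<open>(0, 0)\<close> are \<open>a\<^sup>2 y\<^sup>2\<close>, \<open>x\<^sup>2 - a\<^sup>2 y\<^sup>2\<close>, \<open>y\<^sup>2 - a\<^sup>2 y\<^sup>2\<close> and \<open>1 - x\<^sup>2 - y\<^sup>2 + a\<^sup>2 y\<^sup>2\<close>; only the last
  can be negative. If it is not, a normal extension consists of one pair of bilateral shifts for each
  atom, with the shifts in the vanishing coordinates of the atom replaced by zero
  (\<open>shift_subnormal\<close>). Conversely a normal extension makes this mass nonnegative
  (\<open>normal_pair_moment_inequality\<close>); that step is carried out with the decomposition into kernel and
  range of a single normal operator, in place of the joint spectral measure. Hence the pair fails to be
  subnormal exactly when \<open>y\<close> satisfies the strict lower bound.

  The two bounds on \<open>y\<close> together imply \<open>a < x\<close> (\<open>hyponormal_not_subnormal_imp_less\<close>).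
\<close>

section \<open>Operators on Hilbert spaces\<close>

lemma cinner_self_eq_norm: "Re (cinner x x) = (norm x)\<^sup>2" for x :: "'a::chilbert_space"
  by (simp add: cinner_self)

lemma cinner_zero_left [simp]: "cinner 0 x = 0" for x :: "'a::chilbert_space"
  using cinner_diff_left[of 0 0 x] by simp

lemma norm_scaleC: "norm (c *\<^sub>C x) = cmod c * norm x" for x :: "'a::chilbert_space"
proof -
  have "cinner (c *\<^sub>C x) (c *\<^sub>C x) = c * cnj c * cinner x x"
    by (simp add: cinner_scaleC_left cinner_scaleC_right)
  then have "complex_of_real ((norm (c *\<^sub>C x))\<^sup>2) = complex_of_real ((cmod c * norm x)\<^sup>2)"
    unfolding cinner_self by (simp add: power_mult_distrib flip: complex_norm_square)
  then show ?thesis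
    by (simp only: of_real_eq_iff) simp
qed

lemma bounded_clinear_diff:
  assumes "bounded_clinear T"
  shows "T (u - v) = T u - T v"
  using assms linear_diff[of T] by (simp add: bounded_clinear_def bounded_linear.linear)

lemma bounded_clinear_scaleC:
  assumes "bounded_clinear T"
  shows "T (c *\<^sub>C u) = c *\<^sub>C T u"
  using assms by (simp add: bounded_clinear_def)

lemma bounded_clinear_compose:
  assumes "bounded_clinear S" "bounded_clinear T"
  shows "bounded_clinear (\<lambda>u. S (T u))"
  using assms by (simp add: bounded_clinear_def bounded_linear_compose)

lemma bounded_clinear_sub:
  assumes "bounded_clinear S" "bounded_clinear T"
  shows "bounded_clinear (\<lambda>u. S u - T u)"
proof -
  have "c *\<^sub>C (u - v) = c *\<^sub>C u - c *\<^sub>C v" for c and u v :: 'b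
    using scaleC_add_right[of c "u - v" v] by (simp add: eq_diff_eq)
  then show ?thesis
    using assms by (simp add: bounded_clinear_def bounded_linear_sub)
qed

lemma bounded_clinear_commutator:
  assumes "bounded_clinear S" "bounded_clinear T"
  shows "bounded_clinear (commutator S T)"
  unfolding commutator_def
  by (rule bounded_clinear_sub[OF bounded_clinear_compose[OF assms]
        bounded_clinear_compose[OF assms(2,1)]])

lemma bounded_clinear_op_matrix:
  assumes "bounded_clinear A" "bounded_clinear B" "bounded_clinear C" "bounded_clinear D"
  shows "bounded_clinear (op_matrix A B C D)"
  using assms unfolding bounded_clinear_def op_matrix_def split_def
  by (auto intro!: bounded_linear_Pair bounded_linear_add
      bounded_linear_compose[OF _ bounded_linear_fst] bounded_linear_compose[OF _ bounded_linear_snd]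
      simp: scaleC_prod_def scaleC_add_right)

lemma cinner_cadjoint:
  assumes "bounded_clinear T"
  shows "cinner (cadjoint T u) v = cinner u (T v)"
  by (metis assms cadjoint_cinner cinner_commute)

text \<open>Polarisation: the norm determines the real part of the inner product, and multiplying the
  first argument by \<open>\<i>\<close> recovers the imaginary part.\<close>

lemma isometry_cinner:
  assumes "isometry V"
  shows "cinner (V u) (V v) = cinner u v"
proof -
  have lin: "bounded_clinear V" and norm: "norm (V w) = norm w" for w
    using assms by (auto simp: isometry_def)
  have re: "Re (cinner (V u) (V v)) = Re (cinner u v)" for u v
    using norm_diff_power2[of "V u" "V v"] norm_diff_power2[of u v] norm[of "u - v"]
    by (simp add: bounded_clinear_diff[OF lin, symmetric] norm)
  show ?thesis
    using re[of u v] re[of "\<i> *\<^sub>C u" v]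
    by (intro complex_eqI)
      (auto simp: bounded_clinear_scaleC[OF lin] cinner_scaleC_left)
qed

lemma cadjoint_isometry:
  assumes "isometry V"
  shows "cadjoint V (V u) = u"
proof (rule cinner_ext)
  show "cinner w (cadjoint V (V u)) = cinner w u" for w
    using assms by (simp add: cadjoint_cinner[symmetric] isometry_cinner isometry_def)
qed

lemma isometry_compose:
  assumes "isometry V" "isometry W"
  shows "isometry (W \<circ> V)"
  using assms bounded_clinear_compose[of W V] by (simp add: isometry_def comp_def)

text \<open>A normal pair on \<open>H\<close> becomes a normal pair on any larger space when both operators are
  extended by zero on the orthogonal complement of \<open>H\<close>.\<close>

lemma subnormal_pair_in_isometry:
  fixes W :: "'h::chilbert_space \<Rightarrow> 'k::chilbert_space"
  assumes W: "isometry W" and sub: "subnormal_pair_in TYPE('h) T1 T2"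
  shows "subnormal_pair_in TYPE('k) T1 T2"
proof -
  obtain V :: "_ \<Rightarrow> 'h" and N1 N2 where V: "isometry V" and N: "normal_pair N1 N2"
    and res: "N1 \<circ> V = V \<circ> T1" "N2 \<circ> V = V \<circ> T2"
    and T: "bounded_clinear T1" "bounded_clinear T2"
    using sub unfolding subnormal_pair_in_def by blast
  have linW: "bounded_clinear W" using W by (simp add: isometry_def)
  define lift where "lift N = (\<lambda>u. W (N (cadjoint W u)))" for N :: "'h \<Rightarrow> 'h"
  have lin: "bounded_clinear (lift N)" if "bounded_clinear N" for N
    unfolding lift_def
    by (rule bounded_clinear_compose[OF linW bounded_clinear_compose[OF that
            cadjoint_bounded_clinear[OF linW]]])
  have comp: "lift M \<circ> lift N = lift (M \<circ> N)" for M N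
    by (simp add: lift_def comp_def cadjoint_isometry[OF W])
  have adj: "cadjoint (lift N) = lift (cadjoint N)" if "bounded_clinear N" for N
    by (rule cadjoint_eqI)
      (simp add: lift_def cadjoint_cinner[OF linW] cadjoint_cinner[OF that]
        cinner_cadjoint[OF linW])
  have "normal_pair (lift N1) (lift N2)"
    using N by (simp add: normal_pair_def normal_op_def comp adj lin)
  moreover have "lift N \<circ> (W \<circ> V) = (W \<circ> V) \<circ> T" if "N \<circ> V = V \<circ> T" for N T
    using fun_cong[OF that] by (simp add: lift_def fun_eq_iff cadjoint_isometry[OF W])
  ultimately show ?thesis
    unfolding subnormal_pair_in_def
    using T isometry_compose[OF V W] res by blast
qed

section \<open>Commuting normal operators\<close>

lemma normal_op_norm_cadjoint:
  assumes "normal_op N"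
  shows "norm (cadjoint N u) = norm (N u)"
proof -
  have N: "bounded_clinear N" and c: "cadjoint N (N u) = N (cadjoint N u)"
    using assms by (auto simp: normal_op_def dest: fun_cong)
  have "cinner (cadjoint N u) (cadjoint N u) = cinner (N u) (N u)"
    by (simp add: cinner_cadjoint[OF N] c[symmetric])
      (metis N cadjoint_cinner cinner_commute)
  then show ?thesis
    by (simp add: cinner_self)  (metis norm_ge_zero of_real_eq_iff of_real_power power2_eq_iff_nonneg)
qed

text \<open>Expanding \<open>\<parallel>N\<^sup>* (N u) - u\<parallel>\<^sup>2\<close> leaves only norms of \<open>u\<close>, \<open>N u\<close> and \<open>N (N u)\<close>,
  since \<open>N\<^sup>*\<close> may be replaced by \<open>N\<close> inside a norm.\<close>

lemma normal_op_eigenspace_one: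
  assumes N: "normal_op N"
    and eq: "norm (N (N u)) = norm (N u)" "norm (N u) = norm u"
  shows "cadjoint N (N u) = u"
proof -
  have lin: "bounded_clinear N" using N by (simp add: normal_op_def)
  have "(norm (cadjoint N (N u) - u))\<^sup>2
      = (norm (N (N u)))\<^sup>2 - 2 * (norm (N u))\<^sup>2 + (norm u)\<^sup>2"
    by (simp add: norm_diff_power2 normal_op_norm_cadjoint[OF N] cinner_cadjoint[OF lin]
        cinner_self_eq_norm)
  then show ?thesis using eq by simp
qed

lemma normal_op_norm_diff:
  assumes N: "normal_op N" and eq: "norm (N (N u)) = norm (N u)"
  shows "(norm (u - cadjoint N (N u)))\<^sup>2 = (norm u)\<^sup>2 - (norm (N u))\<^sup>2"
proof -
  have lin: "bounded_clinear N" using N by (simp add: normal_op_def)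
  have "Re (cinner u (cadjoint N (N u))) = (norm (N u))\<^sup>2"
    by (simp add: cadjoint_cinner[OF lin, symmetric] cinner_self_eq_norm)
  then show ?thesis
    by (simp add: norm_diff_power2 normal_op_norm_cadjoint[OF N] eq)
qed

text \<open>When \<open>N u = N (N\<^sup>* (N u))\<close>, the vector \<open>u - N\<^sup>* (N u)\<close> is the component of \<open>u\<close> in the kernel
  of \<open>N\<close>. An operator \<open>S\<close> commuting with \<open>N\<close> maps the kernel and the range of \<open>N\<close> into themselves,
  and these are orthogonal because \<open>N\<close> is normal, so \<open>S\<close> respects the decomposition. This much
  is what the argument needs of Fuglede's theorem, that \<open>S\<close> commutes with \<open>N\<^sup>*\<close>.\<close>

lemma normal_op_kernel_component_commute:
  assumes N: "normal_op N" and S: "bounded_clinear S" and comm: "\<And>v. S (N v) = N (S v)"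
    and u: "N (cadjoint N (N u)) = N u"
    and Su: "N (cadjoint N (N (S u))) = N (S u)"
  shows "S (u - cadjoint N (N u)) = S u - cadjoint N (N (S u))"
proof -
  have lin: "bounded_clinear N" and c: "cadjoint N (N v) = N (cadjoint N v)" for v
    using N by (auto simp: normal_op_def dest: fun_cong)
  \<comment> \<open>the two candidates differ by a vector that is both in the range and in the kernel of \<open>N\<close>\<close>
  define e where "e = cadjoint N (S u) - S (cadjoint N u)"
  define d where "d = cadjoint N (N (S u)) - S (cadjoint N (N u))"
  have range: "d = N e"
    by (simp add: d_def e_def bounded_clinear_diff[OF lin] c comm)
  have "N d = 0"
    using Su u comm by (simp add: d_def bounded_clinear_diff[OF lin]) (metis)
  then have "cadjoint N d = 0"
    using normal_op_norm_cadjoint[OF N, of d] by simp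
  then have "cinner d d = 0"
    by (subst (2) range) (simp add: cinner_cadjoint[OF lin, symmetric])
  then have "d = 0" by (simp add: cinner_self)
  then show ?thesis by (simp add: d_def bounded_clinear_diff[OF S])
qed

lemma normal_op_norm_power2_le:
  assumes N: "normal_op N"
  shows "(norm (N u))\<^sup>2 \<le> norm (N (N u)) * norm u"
proof -
  have lin: "bounded_clinear N" using N by (simp add: normal_op_def)
  have "(norm (N u))\<^sup>2 = norm (cinner (cadjoint N (N u)) u)"
    by (simp add: cinner_cadjoint[OF lin] cinner_self norm_power)
  also have "\<dots> \<le> norm (N (N u)) * norm u"
    using cinner_cauchy_schwarz[of "cadjoint N (N u)" u] normal_op_norm_cadjoint[OF N] by simp
  finally show ?thesis .
qed

text \<open>The squared norm of \<open>N1\<^sup>i (N2\<^sup>j h)\<close> is the moment \<open>\<integral> s\<^sup>i t\<^sup>j\<close> of the distribution of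
  \<open>(s, t) = (\<bar>z1\<bar>\<^sup>2, \<bar>z2\<bar>\<^sup>2)\<close> under the spectral measure of the unit vector \<open>h\<close>. Three equal
  moments in \<open>s\<close> make \<open>\<integral> s (1 - s)\<^sup>2\<close> vanish, so \<open>s \<in> {0, 1}\<close>, and \<open>s = 0\<close> has mass
  \<open>1 - p\<^sup>2\<close>. On that part both \<open>t\<close> and \<open>t\<^sup>2\<close> integrate to \<open>d = q\<^sup>2 - r\<^sup>2\<close>, so the
  Cauchy-Schwarz inequality gives \<open>d\<^sup>2 \<le> d (1 - p\<^sup>2)\<close>. The proof below avoids the spectral
  measure: restricting to \<open>s = 0\<close> means taking the component \<open>w h\<close> of \<open>h\<close> in the kernel of
  \<open>N1\<close>.\<close>

lemma normal_pair_moment_inequality: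
  assumes pair: "normal_pair N1 N2"
    and h: "norm h = 1"
    and N1h: "\<And>i. i < 3 \<Longrightarrow> norm ((N1 ^^ Suc i) h) = p"
    and N2h: "\<And>j. j < 2 \<Longrightarrow> norm ((N2 ^^ Suc j) h) = q"
    and N12h: "\<And>i j. i < 3 \<Longrightarrow> j < 2 \<Longrightarrow> norm ((N1 ^^ Suc i) ((N2 ^^ Suc j) h)) = r"
    and less: "r\<^sup>2 < q\<^sup>2"
  shows "0 \<le> 1 - p\<^sup>2 - q\<^sup>2 + r\<^sup>2"
proof -
  have n1: "normal_op N1" and n2: "normal_op N2" and "N1 \<circ> N2 = N2 \<circ> N1"
    using pair by (auto simp: normal_pair_def)
  then have comm: "N2 (N1 v) = N1 (N2 v)" for v
    by (metis comp_apply)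
  have l2: "bounded_clinear N2" using n2 by (simp add: normal_op_def)
  have c1: "cadjoint N1 (N1 v) = N1 (cadjoint N1 v)" for v
    using n1 by (auto simp: normal_op_def dest: fun_cong)
  have stable: "N1 (cadjoint N1 (N1 u)) = N1 u"
    if "\<And>i. i < 3 \<Longrightarrow> norm ((N1 ^^ Suc i) u) = m" for u m
    using that[of 0] that[of 1] that[of 2] c1
      normal_op_eigenspace_one[OF n1, of "N1 u"]
    by (simp add: numeral_2_eq_2)
  define w where "w u = u - cadjoint N1 (N1 u)" for u
  have norm_w: "(norm (w u))\<^sup>2 = (norm u)\<^sup>2 - m\<^sup>2"
    if "\<And>i. i < 3 \<Longrightarrow> norm ((N1 ^^ Suc i) u) = m" for u m
    using that[of 0] that[of 1] normal_op_norm_diff[OF n1, of u] by (simp add: w_def)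
  have s0: "\<And>i. i < 3 \<Longrightarrow> norm ((N1 ^^ Suc i) h) = p"
    and s1: "\<And>i. i < 3 \<Longrightarrow> norm ((N1 ^^ Suc i) (N2 h)) = r"
    and s2: "\<And>i. i < 3 \<Longrightarrow> norm ((N1 ^^ Suc i) (N2 (N2 h))) = r"
    using N1h N12h[of _ 0] N12h[of _ 1] by auto
  have w1: "N2 (w h) = w (N2 h)" and w2: "N2 (w (N2 h)) = w (N2 (N2 h))"
    unfolding w_def
    using normal_op_kernel_component_commute[OF n1 l2 comm] stable[OF s0] stable[OF s1] stable[OF s2]
    by blast+
  define d where "d = q\<^sup>2 - r\<^sup>2"
  have d1: "(norm (N2 (w h)))\<^sup>2 = d"
    using norm_w[OF s1] N2h[of 0] by (simp add: w1 d_def)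
  have d2: "(norm (N2 (N2 (w h))))\<^sup>2 = d"
    using norm_w[OF s2] N2h[of 1] by (simp add: w1 w2 d_def)
  have d0: "(norm (w h))\<^sup>2 = 1 - p\<^sup>2"
    using norm_w[OF s0] h by simp
  have "d \<le> norm (N2 (N2 (w h))) * norm (w h)"
    using normal_op_norm_power2_le[OF n2, of "w h"] d1 by simp
  then have "d\<^sup>2 \<le> (norm (N2 (N2 (w h))) * norm (w h))\<^sup>2"
    using less by (intro power_mono) (auto simp: d_def)
  also have "\<dots> = d * (1 - p\<^sup>2)"
    by (simp add: power_mult_distrib d0 d2)
  finally have "d \<le> 1 - p\<^sup>2"
    using less by (simp add: power2_eq_square d_def)
  then show ?thesis by (simp add: d_def)
qed

section \<open>Hyponormality of two-variable weighted shifts\<close>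

lemma cinner_ket: "cinner f (ket k) = ell2_coord f k"
proof transfer
  fix f :: "'a \<Rightarrow> complex" and k
  have "((\<lambda>i. f i * cnj (if i = k then 1 else 0)) has_sum f k) UNIV"
    by (rule has_sum_finite_neutralI[of "{k}"]) auto
  then show "(\<Sum>\<^sub>\<infinity>i. f i * cnj (if i = k then 1 else 0)) = f k"
    by (rule infsumI)
qed

lemma norm_ket [simp]: "norm (ket k) = 1"
proof -
  have "(norm (ket k))\<^sup>2 = 1"
    using cinner_self_eq_norm[of "ket k"] by (simp add: cinner_ket ket.rep_eq)
  then show ?thesis by (simp add: power2_eq_1_iff) (metis abs_norm_cancel abs_minus_cancel abs_one)
qed

lemma ell2_coord_cadjoint:
  assumes T: "bounded_clinear T" and ket: "T (ket k) = complex_of_real c *\<^sub>C ket l"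
  shows "ell2_coord (cadjoint T f) k = complex_of_real c * ell2_coord f l"
proof -
  have "ell2_coord (cadjoint T f) k = cinner f (T (ket k))"
    by (simp only: cinner_cadjoint[OF T] flip: cinner_ket)
  then show ?thesis by (simp add: ket cinner_scaleC_right cinner_ket)
qed

lemma infsum_of_real_nonneg:
  assumes "\<And>i. i \<in> A \<Longrightarrow> 0 \<le> f i"
  shows "(\<Sum>\<^sub>\<infinity>i\<in>A. complex_of_real (f i)) \<in> \<real>\<^sub>\<ge>\<^sub>0"
proof (cases "f summable_on A")
  case True
  then have "(\<Sum>\<^sub>\<infinity>i\<in>A. complex_of_real (f i)) = complex_of_real (\<Sum>\<^sub>\<infinity>i\<in>A. f i)"
    by (intro infsumI has_sum_of_real has_sum_infsum)
  then show ?thesis using assms by (simp add: infsum_nonneg)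
next
  case False
  then have "\<not> (\<lambda>i. complex_of_real (f i)) summable_on A"
    using summable_on_Re by force
  then show ?thesis by (simp add: infsum_not_exists)
qed

lemma infsum_nat_prod_split_fst:
  fixes f :: "nat \<times> nat \<Rightarrow> complex"
  assumes f: "f summable_on UNIV"
  shows "(\<lambda>(m, n). f (Suc m, n)) summable_on UNIV"
    and "(\<Sum>\<^sub>\<infinity>k. f k) = (\<Sum>\<^sub>\<infinity>n. f (0, n)) + (\<Sum>\<^sub>\<infinity>(m, n). f (Suc m, n))"
proof -
  let ?Z = "range (\<lambda>n :: nat. (0 :: nat, n))" and ?S = "range (\<lambda>(m :: nat, n :: nat). (Suc m, n))"
  have inj: "inj (\<lambda>n :: nat. (0 :: nat, n))" "inj (\<lambda>(m :: nat, n :: nat). (Suc m, n))"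
    by (auto simp: inj_on_def)
  have "k \<in> ?Z \<union> ?S" for k
    by (cases k; cases "fst k") (auto simp: image_iff)
  then have U: "UNIV = ?Z \<union> ?S" by blast
  have sub: "f summable_on ?Z" "f summable_on ?S"
    using summable_on_subset_banach[OF f] by blast+
  show "(\<lambda>(m, n). f (Suc m, n)) summable_on UNIV"
    using sub(2) unfolding summable_on_reindex[OF inj(2)] by (simp add: comp_def case_prod_beta')
  have "(\<Sum>\<^sub>\<infinity>k. f k) = infsum f ?Z + infsum f ?S"
    by (subst U) (rule infsum_Un_disjoint[OF sub], auto)
  then show "(\<Sum>\<^sub>\<infinity>k. f k) = (\<Sum>\<^sub>\<infinity>n. f (0, n)) + (\<Sum>\<^sub>\<infinity>(m, n). f (Suc m, n))"
    unfolding infsum_reindex[OF inj(1)] infsum_reindex[OF inj(2)] by (simp add: comp_def case_prod_beta')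
qed

lemma infsum_nat_prod_split_snd:
  fixes f :: "nat \<times> nat \<Rightarrow> complex"
  assumes f: "f summable_on UNIV"
  shows "(\<lambda>(m, n). f (m, Suc n)) summable_on UNIV"
    and "(\<Sum>\<^sub>\<infinity>k. f k) = (\<Sum>\<^sub>\<infinity>m. f (m, 0)) + (\<Sum>\<^sub>\<infinity>(m, n). f (m, Suc n))"
proof -
  have swap: "bij (prod.swap :: nat \<times> nat \<Rightarrow> nat \<times> nat)" by (rule bij_swap)
  have f': "(\<lambda>k. f (prod.swap k)) summable_on UNIV"
    using f by (simp add: summable_on_reindex_bij_betw[OF swap])
  note split = infsum_nat_prod_split_fst[OF f']
  show "(\<lambda>(m, n). f (m, Suc n)) summable_on UNIV"
    using split(1) summable_on_reindex_bij_betw[OF swap, of "\<lambda>(m, n). f (m, Suc n)"]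
    by (simp add: case_prod_beta')
  show "(\<Sum>\<^sub>\<infinity>k. f k) = (\<Sum>\<^sub>\<infinity>m. f (m, 0)) + (\<Sum>\<^sub>\<infinity>(m, n). f (m, Suc n))"
    using split(2) infsum_reindex_bij_betw[OF swap, of f]
      infsum_reindex_bij_betw[OF swap, of "\<lambda>(m, n). f (m, Suc n)"]
    by (simp add: case_prod_beta')
qed

text \<open>The quadratic form of the commutator matrix on the two-dimensional space spanned by
  \<open>ket (m + 1, n)\<close> in the first summand and \<open>ket (m, n + 1)\<close> in the second; its coefficients
  involve the weights of the edges joining the six points of \<open>(m, n) + {(i, j). i + j \<le> 2}\<close>.\<close>

definition six_point_form ::
  "(nat \<times> nat \<Rightarrow> real) \<Rightarrow> (nat \<times> nat \<Rightarrow> real) \<Rightarrow> nat \<Rightarrow> nat \<Rightarrow> complex \<Rightarrow> complex \<Rightarrow> real" where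
  "six_point_form \<alpha> \<beta> m n s t =
     ((\<alpha> (Suc m, n))\<^sup>2 - (\<alpha> (m, n))\<^sup>2) * (cmod s)\<^sup>2
   + ((\<beta> (m, Suc n))\<^sup>2 - (\<beta> (m, n))\<^sup>2) * (cmod t)\<^sup>2
   + 2 * (\<alpha> (m, Suc n) * \<beta> (Suc m, n) - \<alpha> (m, n) * \<beta> (m, n)) * Re (s * cnj t)"

lemma hermitian_form_eq:
  fixes a b c :: real and s t :: complex
  shows "(a * s + c * t) * cnj s + (c * s + b * t) * cnj t
     = complex_of_real (a * (cmod s)\<^sup>2 + b * (cmod t)\<^sup>2 + 2 * c * Re (s * cnj t))"
  by (simp add: complex_eq_iff cmod_power2) (simp add: algebra_simps power2_eq_square)

text \<open>In coordinates the commutator matrix couples the first component at \<open>(m + 1, n)\<close> only with the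
  second at \<open>(m, n + 1)\<close>, and acts on the remaining coordinates, first components at \<open>(0, n)\<close>
  and second ones at \<open>(m, 0)\<close>, as multiplication by the squares of weights. It is thus an
  orthogonal sum of two-by-two and nonnegative one-by-one blocks.\<close>

theorem hyponormal_pair_shift_iff:
  assumes \<alpha>: "\<And>k. \<bar>\<alpha> k\<bar> \<le> A" and \<beta>: "\<And>k. \<bar>\<beta> k\<bar> \<le> B"
  shows "hyponormal_pair (shift1 \<alpha>) (shift2 \<beta>) \<longleftrightarrow>
    (\<forall>m n s t. 0 \<le> six_point_form \<alpha> \<beta> m n s t)"
proof -
  let ?T1 = "shift1 \<alpha>" and ?T2 = "shift2 \<beta>"
  have T1: "bounded_clinear ?T1" and T2: "bounded_clinear ?T2"
    using shift1_bounded_clinear[OF \<alpha>] shift2_bounded_clinear[OF \<beta>] .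
  define M where "M = op_matrix
       (commutator (cadjoint ?T1) ?T1) (commutator (cadjoint ?T2) ?T1)
       (commutator (cadjoint ?T1) ?T2) (commutator (cadjoint ?T2) ?T2)"
  have linM: "bounded_clinear M"
    unfolding M_def
    by (rule bounded_clinear_op_matrix; rule bounded_clinear_commutator;
        simp add: T1 T2 cadjoint_bounded_clinear)
  have adj1: "ell2_coord (cadjoint ?T1 f) (m, n) = \<alpha> (m, n) * ell2_coord f (Suc m, n)" for f m n
    by (rule ell2_coord_cadjoint[OF T1]) (simp add: shift1_ket[OF \<alpha>])
  have adj2: "ell2_coord (cadjoint ?T2 f) (m, n) = \<beta> (m, n) * ell2_coord f (m, Suc n)" for f m n
    by (rule ell2_coord_cadjoint[OF T2]) (simp add: shift2_ket[OF \<beta>])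
  define a where "a m n = (\<alpha> (Suc m, n))\<^sup>2 - (\<alpha> (m, n))\<^sup>2" for m n
  define b where "b m n = (\<beta> (m, Suc n))\<^sup>2 - (\<beta> (m, n))\<^sup>2" for m n
  define c where "c m n = \<alpha> (m, Suc n) * \<beta> (Suc m, n) - \<alpha> (m, n) * \<beta> (m, n)" for m n
  note coords = M_def op_matrix_def commutator_def plus_ell2.rep_eq minus_ell2.rep_eq adj1 adj2
    ell2_coord_shift1[OF \<alpha>] ell2_coord_shift2[OF \<beta>] shift1_coord_def shift2_coord_def
    a_def b_def c_def power2_eq_square algebra_simps
  have M1: "ell2_coord (fst (M (u, v))) (Suc m, n)
      = a m n * ell2_coord u (Suc m, n) + c m n * ell2_coord v (m, Suc n)"
    and M2: "ell2_coord (snd (M (u, v))) (m, Suc n)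
      = c m n * ell2_coord u (Suc m, n) + b m n * ell2_coord v (m, Suc n)"
    and M1_0: "ell2_coord (fst (M (u, v))) (0, n) = (\<alpha> (0, n))\<^sup>2 * ell2_coord u (0, n)"
    and M2_0: "ell2_coord (snd (M (u, v))) (m, 0) = (\<beta> (m, 0))\<^sup>2 * ell2_coord v (m, 0)"
    for u v m n
    by (simp_all add: coords)
  have form: "(a m n * s + c m n * t) * cnj s + (c m n * s + b m n * t) * cnj t
      = complex_of_real (six_point_form \<alpha> \<beta> m n s t)"
    for m n and s t :: complex
    unfolding hermitian_form_eq six_point_form_def a_def b_def c_def ..
  have nonneg: "cinner (M (u, v)) (u, v) \<in> \<real>\<^sub>\<ge>\<^sub>0"
    if q: "\<forall>m n s t. 0 \<le> six_point_form \<alpha> \<beta> m n s t" for u v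
  proof -
    let ?u = "ell2_coord u" and ?v = "ell2_coord v"
    define f where "f k = ell2_coord (fst (M (u, v))) k * cnj (?u k)" for k
    define g where "g k = ell2_coord (snd (M (u, v))) k * cnj (?v k)" for k
    have sf: "f summable_on UNIV" and sg: "g summable_on UNIV"
      unfolding f_def g_def by (intro square_summable_product square_summable_ell2_coord)+
    have "(\<Sum>\<^sub>\<infinity>(m, n). f (Suc m, n)) + (\<Sum>\<^sub>\<infinity>(m, n). g (m, Suc n))
        = (\<Sum>\<^sub>\<infinity>(m, n). f (Suc m, n) + g (m, Suc n))"
      using infsum_add[OF infsum_nat_prod_split_fst(1)[OF sf] infsum_nat_prod_split_snd(1)[OF sg]]
      by (simp add: case_prod_beta')
    also have "\<dots> = (\<Sum>\<^sub>\<infinity>k. complex_of_real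
        (six_point_form \<alpha> \<beta> (fst k) (snd k) (?u (Suc (fst k), snd k)) (?v (fst k, Suc (snd k)))))"
      by (simp add: f_def g_def M1 M2 form case_prod_beta')
    also have "\<dots> \<in> \<real>\<^sub>\<ge>\<^sub>0"
      using q by (intro infsum_of_real_nonneg) auto
    finally have inner: "(\<Sum>\<^sub>\<infinity>(m, n). f (Suc m, n)) + (\<Sum>\<^sub>\<infinity>(m, n). g (m, Suc n)) \<in> \<real>\<^sub>\<ge>\<^sub>0" .
    have "f (0, n) = complex_of_real ((\<alpha> (0, n))\<^sup>2 * (cmod (?u (0, n)))\<^sup>2)" for n
      unfolding of_real_mult complex_norm_square by (simp add: f_def M1_0)
    then have edge1: "(\<Sum>\<^sub>\<infinity>n. f (0, n)) \<in> \<real>\<^sub>\<ge>\<^sub>0"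
      by (simp only:) (rule infsum_of_real_nonneg, simp)
    have "g (m, 0) = complex_of_real ((\<beta> (m, 0))\<^sup>2 * (cmod (?v (m, 0)))\<^sup>2)" for m
      unfolding of_real_mult complex_norm_square by (simp add: g_def M2_0)
    then have edge2: "(\<Sum>\<^sub>\<infinity>m. g (m, 0)) \<in> \<real>\<^sub>\<ge>\<^sub>0"
      by (simp only:) (rule infsum_of_real_nonneg, simp)
    have "cinner (M (u, v)) (u, v) = (\<Sum>\<^sub>\<infinity>k. f k) + (\<Sum>\<^sub>\<infinity>k. g k)"
      by (simp add: cinner_prod_def cinner_ell2.rep_eq f_def g_def)
    also have "\<dots> = (\<Sum>\<^sub>\<infinity>n. f (0, n)) + (\<Sum>\<^sub>\<infinity>m. g (m, 0))
        + ((\<Sum>\<^sub>\<infinity>(m, n). f (Suc m, n)) + (\<Sum>\<^sub>\<infinity>(m, n). g (m, Suc n)))"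
      using infsum_nat_prod_split_fst(2)[OF sf] infsum_nat_prod_split_snd(2)[OF sg] by simp
    also have "\<dots> \<in> \<real>\<^sub>\<ge>\<^sub>0"
      by (intro nonneg_Reals_add_I edge1 edge2 inner)
    finally show ?thesis .
  qed
  have point: "cinner (M (s *\<^sub>C ket (Suc m, n), t *\<^sub>C ket (m, Suc n)))
      (s *\<^sub>C ket (Suc m, n), t *\<^sub>C ket (m, Suc n))
      = complex_of_real (six_point_form \<alpha> \<beta> m n s t)" for m n s t
    by (simp add: cinner_prod_def cinner_scaleC_right cinner_ket M1 M2 scaleC_ell2.rep_eq
        ket.rep_eq mult.commute[of "cnj _"] flip: form)
  have "hyponormal_pair ?T1 ?T2 \<longleftrightarrow> (\<forall>z. cinner (M z) z \<in> \<real>\<^sub>\<ge>\<^sub>0)"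
    using T1 T2 linM by (simp add: hyponormal_pair_def positive_op_def flip: M_def)
  also have "\<dots> \<longleftrightarrow> (\<forall>m n s t. 0 \<le> six_point_form \<alpha> \<beta> m n s t)"
    using nonneg point by (metis nonneg_Reals_of_real_iff surj_pair)
  finally show ?thesis .
qed

text \<open>One direction completes the square, the other evaluates the form at \<open>t = a\<close>
  and the corresponding minimiser \<open>s = - c\<close>.\<close>

lemma hermitian_form_nonneg_iff:
  fixes a b c :: real
  assumes a: "0 < a"
  shows "(\<forall>s t. 0 \<le> a * (cmod s)\<^sup>2 + b * (cmod t)\<^sup>2 + 2 * c * Re (s * cnj t)) \<longleftrightarrow> c\<^sup>2 \<le> a * b"
proof
  assume "\<forall>s t. 0 \<le> a * (cmod s)\<^sup>2 + b * (cmod t)\<^sup>2 + 2 * c * Re (s * cnj t)"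
  from this[rule_format, of "complex_of_real (- c)" "complex_of_real a"]
  have "0 \<le> a * (a * b - c\<^sup>2)"
    by (simp add: power2_eq_square algebra_simps)
  then show "c\<^sup>2 \<le> a * b" using a by (simp add: zero_le_mult_iff)
next
  assume le: "c\<^sup>2 \<le> a * b"
  show "\<forall>s t. 0 \<le> a * (cmod s)\<^sup>2 + b * (cmod t)\<^sup>2 + 2 * c * Re (s * cnj t)"
  proof (intro allI)
    fix s t :: complex
    have "a * (a * (cmod s)\<^sup>2 + b * (cmod t)\<^sup>2 + 2 * c * Re (s * cnj t))
        = (cmod (a * s + c * t))\<^sup>2 + (a * b - c\<^sup>2) * (cmod t)\<^sup>2"
      by (simp add: cmod_power2) (simp add: power2_eq_square algebra_simps)
    also have "\<dots> \<ge> 0" using le by simp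
    finally show "0 \<le> a * (cmod s)\<^sup>2 + b * (cmod t)\<^sup>2 + 2 * c * Re (s * cnj t)"
      using a by (simp add: zero_le_mult_iff)
  qed
qed

lemma weight_bounds:
  assumes a: "0 < a" "a < 1" and x: "0 < x" "x < 1" and y: "0 < y" "y < 1" and ayx: "a * y / x < 1"
  shows "\<bar>weight1 a x k\<bar> \<le> 1" and "\<bar>weight2 a x y k\<bar> \<le> 1"
proof -
  have "0 < a * y / x" using a x y by simp
  then show "\<bar>weight1 a x k\<bar> \<le> 1" "\<bar>weight2 a x y k\<bar> \<le> 1"
    using a x y ayx by (auto simp: weight1_def weight2_def split: prod.split)
qed

lemma hyponormal_pair_weights_iff:
  assumes a: "0 < a" "a < 1" and x: "0 < x" "x < 1" and y: "0 < y" "y < 1" and ayx: "a * y / x < 1"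
  shows "hyponormal_pair (shift1 (weight1 a x)) (shift2 (weight2 a x y)) \<longleftrightarrow>
    (y * (a\<^sup>2 - x\<^sup>2) / x)\<^sup>2 \<le> (1 - x\<^sup>2) * (1 - y\<^sup>2)"
proof -
  let ?q = "six_point_form (weight1 a x) (weight2 a x y)"
  have pos: "0 < a * y / x" using a x y by simp
  note w = weight_bounds[OF a x y ayx]
  have sq: "z\<^sup>2 \<le> 1" if "0 < z" "z < 1" for z :: real
    using that by (simp add: power_le_one)
  \<comment> \<open>away from the origin the off-diagonal coefficient vanishes\<close>
  have off: "0 \<le> ?q m n s t" if "(m, n) \<noteq> (0, 0)" for m n s t
    using that sq[OF a] sq[OF x] sq[OF y] sq[OF pos ayx]
    by (cases m; cases n) (auto simp: six_point_form_def weight1_def weight2_def)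
  have org: "?q 0 0 s t = (1 - x\<^sup>2) * (cmod s)\<^sup>2 + (1 - y\<^sup>2) * (cmod t)\<^sup>2
      + 2 * (y * (a\<^sup>2 - x\<^sup>2) / x) * Re (s * cnj t)" for s t
    using x by (simp add: six_point_form_def weight1_def weight2_def power2_eq_square field_simps)
  have "hyponormal_pair (shift1 (weight1 a x)) (shift2 (weight2 a x y)) \<longleftrightarrow>
      (\<forall>s t. 0 \<le> ?q 0 0 s t)"
  proof (subst hyponormal_pair_shift_iff[OF w], intro iffI allI)
    fix m n s t
    assume "\<forall>s t. 0 \<le> ?q 0 0 s t"
    then show "0 \<le> ?q m n s t"
      using off[of m n s t] by (cases "(m, n) = (0, 0)") simp_all
  qed simp
  also have "\<dots> \<longleftrightarrow> (y * (a\<^sup>2 - x\<^sup>2) / x)\<^sup>2 \<le> (1 - x\<^sup>2) * (1 - y\<^sup>2)"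
    unfolding org by (rule hermitian_form_nonneg_iff) (use x in \<open>simp add: power_less_one_iff\<close>)
  finally show ?thesis .
qed

section \<open>Pullbacks between square-summable families\<close>

text \<open>Both the isometries and the normal operators needed for the extension have this shape.\<close>

definition weighted_pullback :: "('j \<Rightarrow> 'i) \<Rightarrow> ('j \<Rightarrow> real) \<Rightarrow> 'i ell2 \<Rightarrow> 'j ell2" where
  "weighted_pullback p w f = Abs_ell2 (\<lambda>j. complex_of_real (w j) * ell2_coord f (p j))"

lemma weighted_pullback_bounded_clinear:
  assumes coord: "\<And>f. ell2_coord (weighted_pullback p w f) = (\<lambda>j. complex_of_real (w j) * ell2_coord f (p j))"
    and bound: "\<And>f. norm (weighted_pullback p w f) \<le> norm f"
  shows "bounded_clinear (weighted_pullback p w)"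
  unfolding bounded_clinear_def
proof (intro conjI allI bounded_linear_intro)
  show "norm (weighted_pullback p w f) \<le> norm f * 1" for f
    using bound by simp
qed (auto simp: ell2_coord_inject[symmetric] coord plus_ell2.rep_eq
    scaleR_ell2.rep_eq scaleC_ell2.rep_eq fun_eq_iff algebra_simps)

text \<open>The pullback spreads each coordinate \<open>f i\<close> over the fibre of \<open>p\<close> above \<open>i\<close>, so the norm is
  preserved as soon as the squared weights of every fibre add up to \<open>1\<close>.\<close>

lemma weighted_pullback_isometry:
  fixes p :: "'j \<Rightarrow> 'i"
  assumes fibre: "\<And>i. ((\<lambda>j. (w j)\<^sup>2) has_sum 1) {j. p j = i}"
  shows "ell2_coord (weighted_pullback p w f) = (\<lambda>j. complex_of_real (w j) * ell2_coord f (p j))"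
    and "isometry (weighted_pullback p w)"
proof -
  have sum: "((\<lambda>j. (cmod (complex_of_real (w j) * ell2_coord f (p j)))\<^sup>2) has_sum (norm f)\<^sup>2) UNIV"
    for f
  proof -
    let ?F = "\<lambda>(i, j). (w j)\<^sup>2 * (cmod (ell2_coord f i))\<^sup>2"
    have inner: "((\<lambda>j. ?F (i, j)) has_sum (cmod (ell2_coord f i))\<^sup>2) {j. p j = i}" for i
      using has_sum_cmult_left[OF fibre[of i], of "(cmod (ell2_coord f i))\<^sup>2"] by simp
    have summable: "(\<lambda>i. (cmod (ell2_coord f i))\<^sup>2) summable_on UNIV"
      using square_summable_ell2_coord[of f] by (simp add: square_summable_def)
    have outer: "((\<lambda>i. (cmod (ell2_coord f i))\<^sup>2) has_sum (norm f)\<^sup>2) UNIV"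
      using has_sum_infsum[OF summable]
      by (simp add: norm_ell2.rep_eq ell2_norm_def infsum_nonneg)
    have "(?F has_sum (norm f)\<^sup>2) (SIGMA i:UNIV. {j. p j = i})"
      by (rule has_sum_SigmaI[OF inner outer], rule summable_on_SigmaI[OF inner summable]) simp
    moreover have "bij_betw (\<lambda>j. (p j, j)) UNIV (SIGMA i:UNIV. {j. p j = i})"
      by (rule bij_betw_byWitness[where f' = snd]) auto
    ultimately show ?thesis
      by (simp add: has_sum_reindex_bij_betw[symmetric] norm_mult power_mult_distrib)
  qed
  have coord: "ell2_coord (weighted_pullback p w f) = (\<lambda>j. complex_of_real (w j) * ell2_coord f (p j))"
    for f
    unfolding weighted_pullback_def
    using has_sum_imp_summable[OF sum[of f]]
    by (intro Abs_ell2_inverse) (simp only: square_summable_def mem_Collect_eq)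
  have norm: "norm (weighted_pullback p w f) = norm f" for f
    using infsumI[OF sum[of f]] unfolding norm_ell2.rep_eq[of "weighted_pullback p w f"]
    by (simp add: coord ell2_norm_def)
  show "ell2_coord (weighted_pullback p w f) = (\<lambda>j. complex_of_real (w j) * ell2_coord f (p j))"
    by (rule coord)
  show "isometry (weighted_pullback p w)"
    unfolding isometry_def by (simp add: weighted_pullback_bounded_clinear[OF coord] norm)
qed

text \<open>The normal extension is built over an index type chosen for convenience; this isometry moves
  it into every space that contains a copy of \<open>(nat \<times> nat) ell2\<close>.\<close>

lemma ell2_countable_isometry: "\<exists>W :: 'i::countable ell2 \<Rightarrow> (nat \<times> nat) ell2. isometry W"
proof
  let ?p = "\<lambda>(k, l :: nat). from_nat k :: 'i"
  let ?w = "\<lambda>(k, l :: nat). of_bool (l = 0 \<and> k \<in> range (to_nat :: 'i \<Rightarrow> nat)) :: real"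
  show "isometry (weighted_pullback ?p ?w)"
  proof (rule weighted_pullback_isometry(2))
    show "((\<lambda>j. (?w j)\<^sup>2) has_sum 1) {j. ?p j = i}" for i
      by (rule has_sum_finite_neutralI[of "{(to_nat i, 0)}"]) auto
  qed
qed

lemma weighted_pullback_permutation:
  fixes p :: "'i \<Rightarrow> 'i"
  assumes p: "bij p" and w: "\<And>j. \<bar>w j\<bar> \<le> 1"
  shows "ell2_coord (weighted_pullback p w f) = (\<lambda>j. complex_of_real (w j) * ell2_coord f (p j))"
    and "bounded_clinear (weighted_pullback p w)"
proof -
  have inv: "inj (inv p)" "range (inv p) = UNIV" "p (inv p j) = j" for j
    using p bij_imp_bij_inv[OF p] by (simp_all add: bij_is_inj bij_is_surj surj_f_inv_f)
  have *: "square_summable (\<lambda>j. complex_of_real (w j) * ell2_coord f (p j))"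
    "ell2_norm (\<lambda>j. complex_of_real (w j) * ell2_coord f (p j)) \<le> 1 * norm f" for f
    unfolding norm_ell2.rep_eq
    using weighted_translate_square_summable[OF square_summable_ell2_coord, of "\<lambda>k. w (inv p k)" 1
        "inv p" "\<lambda>j. complex_of_real (w j) * ell2_coord f (p j)" f] w inv
    by simp_all
  have coord: "ell2_coord (weighted_pullback p w f) = (\<lambda>j. complex_of_real (w j) * ell2_coord f (p j))"
    for f
    unfolding weighted_pullback_def by (rule Abs_ell2_inverse) (simp add: *)
  show "ell2_coord (weighted_pullback p w f) = (\<lambda>j. complex_of_real (w j) * ell2_coord f (p j))"
    by (rule coord)
  show "bounded_clinear (weighted_pullback p w)"
    using *(2) by (intro weighted_pullback_bounded_clinear coord) (simp add: norm_ell2.rep_eq coord)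
qed

text \<open>When the weight is invariant under the permutation, the operator and its adjoint, the pullback
  along the inverse permutation, compose in either order to multiplication by \<open>w\<^sup>2\<close>.\<close>

lemma normal_op_weighted_permutation:
  assumes p: "bij p" and w: "\<And>j. \<bar>w j\<bar> \<le> 1" and inv: "\<And>j. w (p j) = w j"
  shows "normal_op (weighted_pullback p w)"
proof -
  have p': "bij (inv p)" and pp: "p (inv p j) = j" "inv p (p j) = j" for j
    using p by (simp_all add: bij_imp_bij_inv bij_is_inj bij_is_surj surj_f_inv_f)
  have inv': "w (inv p j) = w j" for j
    by (metis inv pp(1))
  note coord = weighted_pullback_permutation(1)[where w = w, OF p w]
    weighted_pullback_permutation(1)[where w = w, OF p' w]
  have "cinner (weighted_pullback p w f) g = cinner f (weighted_pullback (inv p) w g)" for f g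
    using infsum_reindex_bij_betw[OF p,
        of "\<lambda>i. ell2_coord f i * cnj (complex_of_real (w i) * ell2_coord g (inv p i))"]
    by (simp add: cinner_ell2.rep_eq coord inv pp mult_ac)
  then have "cadjoint (weighted_pullback p w) = weighted_pullback (inv p) w"
    by (rule cadjoint_eqI)
  moreover have "weighted_pullback (inv p) w \<circ> weighted_pullback p w
      = weighted_pullback p w \<circ> weighted_pullback (inv p) w"
    by (simp add: fun_eq_iff ell2_coord_inject[symmetric] coord pp inv inv')
  ultimately show ?thesis
    using weighted_pullback_permutation(2)[where w = w, OF p w] by (simp add: normal_op_def)
qed

section \<open>Subnormality of the weighted shift\<close>

text \<open>The masses at the points of \<open>{0, 1}\<^sup>2\<close>, with \<open>True\<close> for \<open>1\<close>, of the only candidate for the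
  joint distribution of \<open>\<bar>z1\<bar>\<^sup>2\<close> and \<open>\<bar>z2\<bar>\<^sup>2\<close> at \<open>ket (0, 0)\<close>: they are determined by the
  moments \<open>(orbit_norm a x y m n)\<^sup>2\<close> defined next.\<close>

definition atom_mass :: "real \<Rightarrow> real \<Rightarrow> real \<Rightarrow> bool \<Rightarrow> bool \<Rightarrow> real" where
  "atom_mass a x y s t =
     (if s then if t then (a * y)\<^sup>2 else x\<^sup>2 - (a * y)\<^sup>2
      else if t then y\<^sup>2 - (a * y)\<^sup>2 else 1 - x\<^sup>2 - y\<^sup>2 + (a * y)\<^sup>2)"

text \<open>The norm of \<open>T1\<^sup>m (T2\<^sup>n (ket (0, 0)))\<close>.\<close>

definition orbit_norm :: "real \<Rightarrow> real \<Rightarrow> real \<Rightarrow> nat \<Rightarrow> nat \<Rightarrow> real" where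
  "orbit_norm a x y m n = (if m = 0 then if n = 0 then 1 else y else if n = 0 then x else a * y)"

text \<open>For each atom \<open>(s, t)\<close> take a copy of \<open>(int \<times> int) ell2\<close>, on which the normal operators act
  as the two bilateral shifts, replaced by \<open>0\<close> in a direction where the atom has coordinate \<open>0\<close>.
  The vector \<open>ket (0, 0)\<close> is sent to the vector with entries \<open>sqrt (atom_mass a x y s t)\<close> at the
  origins of the four copies; the images of the other basis vectors are then forced by the
  intertwining relations, and these are their entries.\<close>

definition embedding_weight ::
  "real \<Rightarrow> real \<Rightarrow> real \<Rightarrow> (int \<times> int) \<times> bool \<times> bool \<Rightarrow> real" where
  "embedding_weight a x y = (\<lambda>((m, n), s, t).
     if 0 \<le> m \<and> 0 \<le> n \<and> (s \<or> m = 0) \<and> (t \<or> n = 0)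
     then sqrt (atom_mass a x y s t) / orbit_norm a x y (nat m) (nat n) else 0)"

text \<open>The image of \<open>ket (k, l)\<close> is a unit vector because the atoms with \<open>s \<or> k = 0\<close> and
  \<open>t \<or> l = 0\<close> have total mass \<open>(orbit_norm a x y k l)\<^sup>2\<close>.\<close>

lemma embedding_weight_fibre:
  assumes a: "0 < a" and x: "0 < x" and y: "0 < y"
    and mass: "\<And>s t. 0 \<le> atom_mass a x y s t"
  shows "((\<lambda>j. (embedding_weight a x y j)\<^sup>2) has_sum 1)
    {j. (\<lambda>((m, n), s, t). (nat m, nat n)) j = (k, l)}"
proof -
  let ?B = "{((int k, int l), True, True), ((int k, int l), True, False),
    ((int k, int l), False, True), ((int k, int l), False, False)}"
  show ?thesis
  proof (rule has_sum_finite_neutralI[of ?B])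
    fix j
    assume j: "j \<in> {j. (\<lambda>((m, n), s, t). (nat m, nat n)) j = (k, l)} - ?B"
    obtain m n s t where mnst: "j = ((m, n), s, t)" by (metis surj_pair)
    have "nat m = k" "nat n = l" using j mnst by auto
    moreover have "(m, n) \<noteq> (int k, int l)" using j mnst by (cases s; cases t) auto
    ultimately have "m < 0 \<or> n < 0" by (metis linorder_not_less nat_0_le)
    then show "(embedding_weight a x y j)\<^sup>2 = 0"
      by (auto simp: mnst embedding_weight_def)
  next
    have ew: "(embedding_weight a x y ((int k, int l), s, t))\<^sup>2
      = (if (s \<or> k = 0) \<and> (t \<or> l = 0) then atom_mass a x y s t / (orbit_norm a x y k l)\<^sup>2 else 0)"
      for s t
      using mass[of s t] by (simp add: embedding_weight_def power_divide)
    have "1 = (embedding_weight a x y ((int k, int l), True, True))\<^sup>2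
      + (embedding_weight a x y ((int k, int l), True, False))\<^sup>2
      + (embedding_weight a x y ((int k, int l), False, True))\<^sup>2
      + (embedding_weight a x y ((int k, int l), False, False))\<^sup>2"
      unfolding ew using a x y
      by (cases k; cases l) (simp_all add: atom_mass_def orbit_norm_def flip: add_divide_distrib)
    then show "1 = (\<Sum>j\<in>?B. (embedding_weight a x y j)\<^sup>2)"
      by simp
  qed auto
qed

theorem shift_subnormal:
  assumes a: "0 < a" "a < 1" and x: "0 < x" "x < 1" and y: "0 < y" "y < 1" and ayx: "a * y / x < 1"
    and origin: "0 \<le> 1 - x\<^sup>2 - y\<^sup>2 + (a * y)\<^sup>2"
  shows "subnormal_pair_in TYPE(((int \<times> int) \<times> bool \<times> bool) ell2)
    (shift1 (weight1 a x)) (shift2 (weight2 a x y))"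
proof -
  let ?w = "embedding_weight a x y"
  let ?p = "\<lambda>((m, n), s :: bool, t :: bool). (nat m, nat n)"
  note bd = weight_bounds[OF a x y ayx]
  have "a * y \<le> x" "a * y \<le> y"
    using a x y ayx by (simp_all add: field_simps)
  then have "(a * y)\<^sup>2 \<le> x\<^sup>2" "(a * y)\<^sup>2 \<le> y\<^sup>2"
    using a y by (intro power_mono; simp)+
  then have mass: "0 \<le> atom_mass a x y s t" for s t
    using origin by (simp add: atom_mass_def)
  have fibre: "((\<lambda>j. (?w j)\<^sup>2) has_sum 1) {j. ?p j = i}" for i
    using embedding_weight_fibre[OF a(1) x(1) y(1) mass] by (cases i) simp
  note V = weighted_pullback_isometry[of ?w ?p, OF fibre]
  define p1 :: "(int \<times> int) \<times> bool \<times> bool \<Rightarrow> _" where "p1 = (\<lambda>((m, n), st). ((m - 1, n), st))"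
  define p2 :: "(int \<times> int) \<times> bool \<times> bool \<Rightarrow> _" where "p2 = (\<lambda>((m, n), st). ((m, n - 1), st))"
  define w1 :: "(int \<times> int) \<times> bool \<times> bool \<Rightarrow> real" where "w1 = (\<lambda>(mn, s, t). of_bool s)"
  define w2 :: "(int \<times> int) \<times> bool \<times> bool \<Rightarrow> real" where "w2 = (\<lambda>(mn, s, t). of_bool t)"
  have p1: "bij p1"
    unfolding p1_def
    by (rule bij_betw_byWitness[where f' = "\<lambda>((m, n), st). ((m + 1, n), st)"]) auto
  have p2: "bij p2"
    unfolding p2_def
    by (rule bij_betw_byWitness[where f' = "\<lambda>((m, n), st). ((m, n + 1), st)"]) auto
  have w: "\<bar>w1 j\<bar> \<le> 1" "\<bar>w2 j\<bar> \<le> 1" for j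
    by (auto simp: w1_def w2_def split: prod.split)
  have wp: "w1 (p1 j) = w1 j" "w2 (p2 j) = w2 j" "w1 (p2 j) = w1 j" "w2 (p1 j) = w2 j"
    "p1 (p2 j) = p2 (p1 j)" for j
    by (auto simp: w1_def w2_def p1_def p2_def split: prod.split)
  let ?N1 = "weighted_pullback p1 w1" and ?N2 = "weighted_pullback p2 w2"
  note N1 = weighted_pullback_permutation(1)[where w = w1, OF p1 w(1)]
    and N2 = weighted_pullback_permutation(1)[where w = w2, OF p2 w(2)]
  have "?N1 \<circ> ?N2 = ?N2 \<circ> ?N1"
    by (simp add: fun_eq_iff ell2_coord_inject[symmetric] N1 N2 wp)
  then have normal: "normal_pair ?N1 ?N2"
    unfolding normal_pair_def
    using normal_op_weighted_permutation[where w = w1, OF p1 w(1) wp(1)]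
      normal_op_weighted_permutation[where w = w2, OF p2 w(2) wp(2)] by blast
  have p1_app: "p1 ((m, n), st) = ((m - 1, n), st)" and p2_app: "p2 ((m, n), st) = ((m, n - 1), st)"
    for m n st by (simp_all add: p1_def p2_def)
  have step1: "w1 ((m, n), s, t) * ?w ((m - 1, n), s, t)
      = (if nat m = 0 then 0 else ?w ((m, n), s, t) * weight1 a x (nat m - 1, nat n))" for m n s t
    using a x y by (auto simp: w1_def embedding_weight_def orbit_norm_def weight1_def)
  have step2: "w2 ((m, n), s, t) * ?w ((m, n - 1), s, t)
      = (if nat n = 0 then 0 else ?w ((m, n), s, t) * weight2 a x y (nat m, nat n - 1))" for m n s t
    using a x y by (auto simp: w2_def embedding_weight_def orbit_norm_def weight2_def)
  have "ell2_coord (?N1 (weighted_pullback ?p ?w f)) ((m, n), s, t)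
      = ell2_coord (weighted_pullback ?p ?w (shift1 (weight1 a x) f)) ((m, n), s, t)" for f m n s t
    using step1[of m n s t]
    by (simp add: N1 V(1) ell2_coord_shift1[OF bd(1)] shift1_coord_def p1_app nat_diff_distrib'
        flip: of_real_mult mult.assoc)
  then have res1: "?N1 \<circ> weighted_pullback ?p ?w = weighted_pullback ?p ?w \<circ> shift1 (weight1 a x)"
    by (auto simp: fun_eq_iff ell2_coord_inject[symmetric])
  have "ell2_coord (?N2 (weighted_pullback ?p ?w f)) ((m, n), s, t)
      = ell2_coord (weighted_pullback ?p ?w (shift2 (weight2 a x y) f)) ((m, n), s, t)" for f m n s t
    using step2[of m n s t]
    by (simp add: N2 V(1) ell2_coord_shift2[OF bd(2)] shift2_coord_def p2_app nat_diff_distrib'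
        flip: of_real_mult mult.assoc)
  then have res2: "?N2 \<circ> weighted_pullback ?p ?w = weighted_pullback ?p ?w \<circ> shift2 (weight2 a x y)"
    by (auto simp: fun_eq_iff ell2_coord_inject[symmetric])
  have "bounded_clinear (shift1 (weight1 a x))" "bounded_clinear (shift2 (weight2 a x y))"
    by (rule shift1_bounded_clinear, rule bd) (rule shift2_bounded_clinear, rule bd)
  then show ?thesis
    unfolding subnormal_pair_in_def using V(2) normal res1 res2 by blast
qed

lemma norm_shift_powers_ket:
  assumes a: "0 < a" "a < 1" and x: "0 < x" "x < 1" and y: "0 < y" "y < 1" and ayx: "a * y / x < 1"
  defines "T1 \<equiv> shift1 (weight1 a x)" and "T2 \<equiv> shift2 (weight2 a x y)"
  shows "norm ((T1 ^^ Suc i) (ket (0, 0))) = x"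
    and "norm ((T2 ^^ Suc j) (ket (0, 0))) = y"
    and "norm ((T1 ^^ Suc i) ((T2 ^^ Suc j) (ket (0, 0)))) = a * y"
proof -
  note bd = weight_bounds[OF a x y ayx]
  have lin: "T1 (c *\<^sub>C u) = c *\<^sub>C T1 u" "T2 (c *\<^sub>C u) = c *\<^sub>C T2 u" for c u
    unfolding T1_def T2_def
    by (rule bounded_clinear_scaleC, rule shift1_bounded_clinear, rule bd,
        rule bounded_clinear_scaleC, rule shift2_bounded_clinear, rule bd)
  have one: "1 *\<^sub>C u = u" for u :: "(nat \<times> nat) ell2"
    using scaleR_scaleC[of 1 u] by simp
  have T1: "T1 (ket (m, n)) = complex_of_real (weight1 a x (m, n)) *\<^sub>C ket (Suc m, n)"
    and T2: "T2 (ket (m, n)) = complex_of_real (weight2 a x y (m, n)) *\<^sub>C ket (m, Suc n)" for m n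
    using shift1_ket[OF bd(1)] shift2_ket[OF bd(2)] by (simp_all add: T1_def T2_def)
  have pow1: "(T1 ^^ Suc i) (c *\<^sub>C ket (0, n)) = (c * complex_of_real (weight1 a x (0, n))) *\<^sub>C ket (Suc i, n)"
    for i n c
    by (induction i) (simp_all add: lin T1 scaleC_scaleC one weight1_def)
  have pow2: "(T2 ^^ Suc j) (ket (0, 0)) = complex_of_real y *\<^sub>C ket (0, Suc j)" for j
    by (induction j) (simp_all add: lin T2 scaleC_scaleC one weight2_def)
  show "norm ((T1 ^^ Suc i) (ket (0, 0))) = x"
    using pow1[of i 1 0] x by (simp add: one norm_scaleC weight1_def del: funpow.simps)
  show "norm ((T2 ^^ Suc j) (ket (0, 0))) = y"
    using y by (simp add: pow2 norm_scaleC del: funpow.simps)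
  show "norm ((T1 ^^ Suc i) ((T2 ^^ Suc j) (ket (0, 0)))) = a * y"
    using a y by (simp add: pow1 pow2 norm_scaleC weight1_def norm_mult del: funpow.simps)
qed

lemma intertwine_funpow:
  assumes "N \<circ> V = V \<circ> T"
  shows "(N ^^ i) (V u) = V ((T ^^ i) u)"
  using fun_cong[OF assms] by (induction i) simp_all

text \<open>Subnormality is thus the nonnegativity of the one atom whose mass can be negative, the one at
  the origin.\<close>

theorem shift_subnormal_iff:
  fixes J :: "(nat \<times> nat) ell2 \<Rightarrow> 'k::chilbert_space"
  assumes a: "0 < a" "a < 1" and x: "0 < x" "x < 1" and y: "0 < y" "y < 1" and ayx: "a * y / x < 1"
    and J: "isometry J"
  shows "subnormal_pair_in TYPE('k) (shift1 (weight1 a x)) (shift2 (weight2 a x y)) \<longleftrightarrow>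
    0 \<le> 1 - x\<^sup>2 - y\<^sup>2 + (a * y)\<^sup>2"
proof
  assume "0 \<le> 1 - x\<^sup>2 - y\<^sup>2 + (a * y)\<^sup>2"
  from shift_subnormal[OF a x y ayx this]
  have "subnormal_pair_in TYPE(((int \<times> int) \<times> bool \<times> bool) ell2)
    (shift1 (weight1 a x)) (shift2 (weight2 a x y))" .
  then show "subnormal_pair_in TYPE('k) (shift1 (weight1 a x)) (shift2 (weight2 a x y))"
    using ell2_countable_isometry subnormal_pair_in_isometry isometry_compose[OF _ J] by metis
next
  let ?T1 = "shift1 (weight1 a x)" and ?T2 = "shift2 (weight2 a x y)"
  assume "subnormal_pair_in TYPE('k) ?T1 ?T2"
  then obtain V :: "(nat \<times> nat) ell2 \<Rightarrow> 'k" and N1 N2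
    where V: "isometry V" and pair: "normal_pair N1 N2"
      and res: "N1 \<circ> V = V \<circ> ?T1" "N2 \<circ> V = V \<circ> ?T2"
    unfolding subnormal_pair_in_def by blast
  have norm: "norm (V u) = norm u" for u using V by (simp add: isometry_def)
  note pow = norm_shift_powers_ket[OF a x y ayx]
  have "(a * y)\<^sup>2 < y\<^sup>2"
    using a y by (simp add: power_mult_distrib power_less_one_iff)
  then show "0 \<le> 1 - x\<^sup>2 - y\<^sup>2 + (a * y)\<^sup>2"
    by (intro normal_pair_moment_inequality[OF pair, of "V (ket (0, 0))"])
      (simp_all only: intertwine_funpow[OF res(1)] intertwine_funpow[OF res(2)] norm pow norm_ket)
qed

section \<open>The parameter region\<close>

lemma origin_mass_neg_iff:
  fixes a x y :: real
  assumes a: "0 < a" "a < 1" and x: "0 < x" "x < 1" and y: "0 < y"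
  shows "1 - x\<^sup>2 - y\<^sup>2 + (a * y)\<^sup>2 < 0 \<longleftrightarrow> sqrt ((1 - x\<^sup>2) / (1 - a\<^sup>2)) < y"
proof -
  have "0 < 1 - a\<^sup>2" using a by (simp add: power_less_one_iff)
  then have "1 - x\<^sup>2 - y\<^sup>2 + (a * y)\<^sup>2 < 0 \<longleftrightarrow> (1 - x\<^sup>2) / (1 - a\<^sup>2) < y\<^sup>2"
    by (simp add: pos_divide_less_eq power_mult_distrib algebra_simps)
  also have "\<dots> \<longleftrightarrow> sqrt ((1 - x\<^sup>2) / (1 - a\<^sup>2)) < sqrt (y\<^sup>2)" by (simp only: real_sqrt_less_iff)
  finally show ?thesis using y by simp
qed

text \<open>The denominator is \<open>(a\<^sup>2 - x\<^sup>2)\<^sup>2 + x\<^sup>2 (1 - x\<^sup>2)\<close>: it collects the coefficients of \<open>y\<^sup>2\<close> in the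
  determinant condition.\<close>

lemma six_point_origin_iff:
  fixes a x y :: real
  assumes x: "0 < x" "x < 1" and y: "0 < y"
  shows "0 < x\<^sup>2 + a^4 - 2 * a\<^sup>2 * x\<^sup>2"
    and "(y * (a\<^sup>2 - x\<^sup>2) / x)\<^sup>2 \<le> (1 - x\<^sup>2) * (1 - y\<^sup>2) \<longleftrightarrow>
      y\<^sup>2 \<le> x\<^sup>2 * ((1 - x\<^sup>2) / (x\<^sup>2 + a^4 - 2 * a\<^sup>2 * x\<^sup>2))"
    and "(y * (a\<^sup>2 - x\<^sup>2) / x)\<^sup>2 \<le> (1 - x\<^sup>2) * (1 - y\<^sup>2) \<longleftrightarrow>
      y \<le> x * sqrt ((1 - x\<^sup>2) / (x\<^sup>2 + a^4 - 2 * a\<^sup>2 * x\<^sup>2))"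
proof -
  define D where "D = x\<^sup>2 + a^4 - 2 * a\<^sup>2 * x\<^sup>2"
  have x2: "0 < x\<^sup>2" "x\<^sup>2 < 1" using x by (simp_all add: power_less_one_iff)
  have D: "D = (a\<^sup>2 - x\<^sup>2)\<^sup>2 + x\<^sup>2 * (1 - x\<^sup>2)"
    by (simp add: D_def power2_eq_square power4_eq_xxxx algebra_simps)
  have "0 < D"
    unfolding D using x2 by (intro add_nonneg_pos) simp_all
  have "(y * (a\<^sup>2 - x\<^sup>2) / x)\<^sup>2 \<le> (1 - x\<^sup>2) * (1 - y\<^sup>2) \<longleftrightarrow>
      y\<^sup>2 * (a\<^sup>2 - x\<^sup>2)\<^sup>2 \<le> (1 - x\<^sup>2) * (1 - y\<^sup>2) * x\<^sup>2"
    using x2 by (simp add: power_divide power_mult_distrib pos_divide_le_eq)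
  also have "\<dots> \<longleftrightarrow> y\<^sup>2 * D \<le> x\<^sup>2 * (1 - x\<^sup>2)"
    unfolding D by (simp add: algebra_simps)
  also have "\<dots> \<longleftrightarrow> y\<^sup>2 \<le> x\<^sup>2 * ((1 - x\<^sup>2) / D)"
    using \<open>0 < D\<close> by (simp add: pos_le_divide_eq)
  finally have sq: "(y * (a\<^sup>2 - x\<^sup>2) / x)\<^sup>2 \<le> (1 - x\<^sup>2) * (1 - y\<^sup>2) \<longleftrightarrow> y\<^sup>2 \<le> x\<^sup>2 * ((1 - x\<^sup>2) / D)" .
  have "x\<^sup>2 * ((1 - x\<^sup>2) / D) = (x * sqrt ((1 - x\<^sup>2) / D))\<^sup>2"
    using x2 \<open>0 < D\<close> by (simp add: power_mult_distrib)
  then have "y\<^sup>2 \<le> x\<^sup>2 * ((1 - x\<^sup>2) / D) \<longleftrightarrow> y \<le> x * sqrt ((1 - x\<^sup>2) / D)"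
    using x2 x y \<open>0 < D\<close> by (simp add: power_mono_iff)
  with sq show "(y * (a\<^sup>2 - x\<^sup>2) / x)\<^sup>2 \<le> (1 - x\<^sup>2) * (1 - y\<^sup>2) \<longleftrightarrow>
      y \<le> x * sqrt ((1 - x\<^sup>2) / (x\<^sup>2 + a^4 - 2 * a\<^sup>2 * x\<^sup>2))"
    and "(y * (a\<^sup>2 - x\<^sup>2) / x)\<^sup>2 \<le> (1 - x\<^sup>2) * (1 - y\<^sup>2) \<longleftrightarrow>
      y\<^sup>2 \<le> x\<^sup>2 * ((1 - x\<^sup>2) / (x\<^sup>2 + a^4 - 2 * a\<^sup>2 * x\<^sup>2))"
    and "0 < x\<^sup>2 + a^4 - 2 * a\<^sup>2 * x\<^sup>2"
    using \<open>0 < D\<close> by (simp_all add: D_def)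
qed

text \<open>The lower bound for \<open>y\<^sup>2\<close> lies below the upper one only if
  \<open>x\<^sup>2 + a\<^sup>4 - 2 a\<^sup>2 x\<^sup>2 < x\<^sup>2 (1 - a\<^sup>2)\<close>, which says \<open>a\<^sup>4 < a\<^sup>2 x\<^sup>2\<close>.\<close>

lemma hyponormal_not_subnormal_imp_less:
  fixes a x y :: real
  assumes a: "0 < a" "a < 1" and x: "0 < x" "x < 1"
    and neg: "1 - x\<^sup>2 - y\<^sup>2 + (a * y)\<^sup>2 < 0"
    and D: "0 < x\<^sup>2 + a^4 - 2 * a\<^sup>2 * x\<^sup>2"
    and le: "y\<^sup>2 \<le> x\<^sup>2 * ((1 - x\<^sup>2) / (x\<^sup>2 + a^4 - 2 * a\<^sup>2 * x\<^sup>2))"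
  shows "a < x"
proof -
  let ?D = "x\<^sup>2 + a^4 - 2 * a\<^sup>2 * x\<^sup>2"
  have pos: "0 < 1 - a\<^sup>2" "0 < 1 - x\<^sup>2" using a x by (simp_all add: power_less_one_iff)
  have "(1 - x\<^sup>2) * ?D < y\<^sup>2 * (1 - a\<^sup>2) * ?D"
    using neg D by (intro mult_strict_right_mono) (simp_all add: power_mult_distrib algebra_simps)
  also have "\<dots> = (y\<^sup>2 * ?D) * (1 - a\<^sup>2)" by (simp add: algebra_simps)
  also have "\<dots> \<le> (x\<^sup>2 * (1 - x\<^sup>2)) * (1 - a\<^sup>2)"
    using le D pos by (intro mult_right_mono) (simp_all add: pos_le_divide_eq)
  finally have "(1 - x\<^sup>2) * ?D < (1 - x\<^sup>2) * (x\<^sup>2 * (1 - a\<^sup>2))"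
    by (simp add: mult_ac)
  then have "?D < x\<^sup>2 * (1 - a\<^sup>2)" using pos(2) by simp
  then have "a\<^sup>2 * a\<^sup>2 < a\<^sup>2 * x\<^sup>2"
    by (simp add: algebra_simps power2_eq_square power4_eq_xxxx)
  then have "a\<^sup>2 < x\<^sup>2" by (rule mult_left_less_imp_less) simp
  then show "a < x" using x by (simp add: power_less_imp_less_base)
qed

theorem theorem3p13:
  fixes a x y :: real
    and T1 T2 :: "(nat \<times> nat) ell2 \<Rightarrow> (nat \<times> nat) ell2"
    and J :: "(nat \<times> nat) ell2 \<Rightarrow> 'k::chilbert_space"
  assumes "0 < a" "a < 1" "0 < x" "0 < y" "Max {x, y, a * y / x} < 1"
    and "T1 = shift1 (weight1 a x)" "T2 = shift2 (weight2 a x y)"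
    and "isometry J"
  shows "(hyponormal_pair T1 T2 \<and> \<not> subnormal_pair_in TYPE('k) T1 T2) \<longleftrightarrow>
    (x > a \<and> sqrt ((1 - x\<^sup>2) / (1 - a\<^sup>2)) < y \<and>
     y \<le> x * sqrt ((1 - x\<^sup>2) / (x\<^sup>2 + a^4 - 2 * a\<^sup>2 * x\<^sup>2)))"
proof -
  have a: "0 < a" "a < 1" and x: "0 < x" "x < 1" and y: "0 < y" "y < 1" and ayx: "a * y / x < 1"
    using assms by auto
  note six = six_point_origin_iff[OF x y(1), of a]
  have "hyponormal_pair T1 T2 \<longleftrightarrow> y \<le> x * sqrt ((1 - x\<^sup>2) / (x\<^sup>2 + a^4 - 2 * a\<^sup>2 * x\<^sup>2))"
    unfolding assms(6,7) hyponormal_pair_weights_iff[OF a x y ayx] six(3) ..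
  moreover have "\<not> subnormal_pair_in TYPE('k) T1 T2 \<longleftrightarrow> sqrt ((1 - x\<^sup>2) / (1 - a\<^sup>2)) < y"
    unfolding assms(6,7) shift_subnormal_iff[OF a x y ayx \<open>isometry J\<close>] not_le
    by (rule origin_mass_neg_iff[OF a x y(1)])
  moreover have "a < x"
    if "sqrt ((1 - x\<^sup>2) / (1 - a\<^sup>2)) < y" "y \<le> x * sqrt ((1 - x\<^sup>2) / (x\<^sup>2 + a^4 - 2 * a\<^sup>2 * x\<^sup>2))"
    using hyponormal_not_subnormal_imp_less[OF a x] origin_mass_neg_iff[OF a x y(1)] six that
    by blast
  ultimately show ?thesis by blast
qed

end
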